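(* Let $(W,S)$ be an arbitrary Coxeter system, let $X_W$ be its Coxeter quandle, and let $\phi\colon\mathrm{Ad}(X_W)\to W$, $e_x\mapsto x$ ($x\in X_W$). Then the commutative square of groups $$\begin{array}{ccc}\mathrm{Ad}(X_W)&\xrightarrow{\ \mathrm{ab}\ }&\mathbb{Z}^{c(W)}\\ {\scriptstyle\phi}\downarrow&&\downarrow{\scriptstyle\mathrm{proj}}\\ W&\xrightarrow{\ \mathrm{ab}\ }&(\mathbb{Z}/2)^{c(W)}\end{array}$$ is a pullback, where the horizontal maps are the abelianization maps (composed with the identifications $\mathrm{Ad}(X_W)_{\mathrm{ab}}\cong\mathbb{Z}^{c(W)}$ and $W_{\mathrm{ab}}\cong(\mathbb{Z}/2)^{c(W)}$ described in the context) and $\mathrm{proj}$ is the canonical projection (reduction mod $2$).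
   Context: A Coxeter system $(W,S)$ consists of a set $S$ and a map $m\colon S\times S\to\mathbb{N}\cup\{\infty\}$ with $m(s,t)=m(t,s)$ and $m(s,t)=1$ iff $s=t$, together with the group $W=\langle s\in S\mid (st)^{m(s,t)}=1\text{ for }m(s,t)<\infty\rangle$. A quandle is a set $X$ with a binary operation $*$ such that $x*x=x$, $(x*y)*z=(x*z)*(y*z)$, and $x\mapsto x*y$ is bijective for every $y$. A conjugation-closed subset of a group is a quandle with $x*y=y^{-1}xy$. The Coxeter quandle $X_W$ is the set of reflections $\{w^{-1}sw\mid w\in W,\ s\in S\}$ with this operation. The adjoint group of a quandle $X$ is $\mathrm{Ad}(X)=\langle e_x\ (x\in X)\mid e_{x*y}=e_y^{-1}e_xe_y\rangle$. $\mathcal{R}_W\subset S$ is a complete set of representatives of $S/\sim$, where $s\sim t$ if $s,t$ are conjugate in $W$, and $c(W)$ is the cardinality of $\mathcal{R}_W$. $G_{\mathrm{ab}}$ denotes the abelianization of a group $G$. It is known that $W_{\mathrm{ab}}$ is a $\mathbb{Z}/2$-vector space with basis $\{[x]\mid x\in\mathcal{R}_W\}$ and $\mathrm{Ad}(X_W)_{\mathrm{ab}}$ is a free abelian group with basis $\{[e_x]\mid x\in\mathcal{R}_W\}$; these bases give the identifications $W_{\mathrm{ab}}\cong(\mathbb{Z}/2)^{c(W)}$ and $\mathrm{Ad}(X_W)_{\mathrm{ab}}\cong\mathbb{Z}^{c(W)}$ (direct sums of copies indexed by $\mathcal{R}_W$). *)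

theory Defs
  imports "HOL-Algebra.Free_Abelian_Groups" "HOL-Algebra.Generated_Groups" "HOL-Library.Extended_Nat"
begin

section \<open>Groups given by generators and relations\<close>

text \<open>
  A word in the generators \<open>X\<close> and their formal inverses is a list of letters; the letter
  \<open>(x, True)\<close> stands for \<open>x\<close> and \<open>(x, False)\<close> for its formal inverse.
  A relation \<open>u = v\<close> is the pair of words \<open>(u, v)\<close>.
\<close>

type_synonym 'x gword = "('x \<times> bool) list"

inductive_set pres_cong :: "'x set \<Rightarrow> ('x gword \<times> 'x gword) set \<Rightarrow> ('x gword \<times> 'x gword) set"
  for X R
where
  refl: "w \<in> lists (X \<times> UNIV) \<Longrightarrow> (w, w) \<in> pres_cong X R"
| sym: "(u, v) \<in> pres_cong X R \<Longrightarrow> (v, u) \<in> pres_cong X R"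
| trans: "(u, v) \<in> pres_cong X R \<Longrightarrow> (v, w) \<in> pres_cong X R \<Longrightarrow> (u, w) \<in> pres_cong X R"
| cancel: "x \<in> X \<Longrightarrow> u \<in> lists (X \<times> UNIV) \<Longrightarrow> v \<in> lists (X \<times> UNIV) \<Longrightarrow>
    (u @ [(x, b), (x, \<not> b)] @ v, u @ v) \<in> pres_cong X R"
| rel: "(l, r) \<in> R \<Longrightarrow> l \<in> lists (X \<times> UNIV) \<Longrightarrow> r \<in> lists (X \<times> UNIV) \<Longrightarrow>
    u \<in> lists (X \<times> UNIV) \<Longrightarrow> v \<in> lists (X \<times> UNIV) \<Longrightarrow>
    (u @ l @ v, u @ r @ v) \<in> pres_cong X R"

definition pres_group :: "'x set \<Rightarrow> ('x gword \<times> 'x gword) set \<Rightarrow> 'x gword set monoid" where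
  "pres_group X R =
    \<lparr>carrier = lists (X \<times> UNIV) // pres_cong X R,
     monoid.mult = (\<lambda>A B. \<Union>a\<in>A. \<Union>b\<in>B. pres_cong X R `` {a @ b}),
     one = pres_cong X R `` {[]}\<rparr>"

definition pres_gen :: "'x set \<Rightarrow> ('x gword \<times> 'x gword) set \<Rightarrow> 'x \<Rightarrow> 'x gword set" where
  "pres_gen X R x = pres_cong X R `` {[(x, True)]}"

primrec gword_eval :: "('g, 'm) monoid_scheme \<Rightarrow> ('x \<Rightarrow> 'g) \<Rightarrow> 'x gword \<Rightarrow> 'g" where
  "gword_eval G f [] = \<one>\<^bsub>G\<^esub>"
| "gword_eval G f (a # w) =
    (if snd a then f (fst a) else inv\<^bsub>G\<^esub> (f (fst a))) \<otimes>\<^bsub>G\<^esub> gword_eval G f w"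

text \<open>
  The homomorphism out of a presented group determined by the images \<open>f x\<close> of the generators:
  all words in a congruence class have the same value as soon as \<open>f\<close> respects the relations
  (see \<open>pres_lift_hom\<close> and \<open>pres_lift_gen\<close>).
\<close>

definition pres_lift :: "('g, 'm) monoid_scheme \<Rightarrow> ('x \<Rightarrow> 'g) \<Rightarrow> 'x gword set \<Rightarrow> 'g" where
  "pres_lift G f A = the_elem (gword_eval G f ` A)"

lemma pres_cong_lists:
  "(u, v) \<in> pres_cong X R \<Longrightarrow> u \<in> lists (X \<times> UNIV) \<and> v \<in> lists (X \<times> UNIV)"
  by (induction rule: pres_cong.induct) auto

lemma equiv_pres_cong: "equiv (lists (X \<times> UNIV)) (pres_cong X R)"
proof (rule equivI)
  show "pres_cong X R \<subseteq> lists (X \<times> UNIV) \<times> lists (X \<times> UNIV)"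
    using pres_cong_lists by fastforce
  show "refl_on (lists (X \<times> UNIV)) (pres_cong X R)"
    by (rule refl_onI) (rule pres_cong.refl)
  show "Relation.sym (pres_cong X R)"
    by (rule symI) (rule pres_cong.sym)
  show "Relation.trans (pres_cong X R)"
    by (rule transI) (rule pres_cong.trans)
qed

lemma pres_cong_context:
  assumes "(u, v) \<in> pres_cong X R" "p \<in> lists (X \<times> UNIV)" "q \<in> lists (X \<times> UNIV)"
  shows "(p @ u @ q, p @ v @ q) \<in> pres_cong X R"
  using assms
proof (induction rule: pres_cong.induct)
  case (refl w) then show ?case by (intro pres_cong.refl) auto
next
  case (sym u v) then show ?case by (blast intro: pres_cong.sym)
next
  case (trans u v w) then show ?case by (blast intro: pres_cong.trans)
next
  case (cancel x u v b)
  then show ?case using pres_cong.cancel[of x X "p @ u" "v @ q" b R] by auto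
next
  case (rel l r u v)
  then show ?case using pres_cong.rel[of l r R X "p @ u" "v @ q"] by auto
qed

lemma pres_cong_append:
  assumes "(u, u') \<in> pres_cong X R" "(v, v') \<in> pres_cong X R"
  shows "(u @ v, u' @ v') \<in> pres_cong X R"
  using pres_cong_context[OF assms(1), of "[]" v] pres_cong_context[OF assms(2), of u' "[]"]
    pres_cong_lists[OF assms(1)] pres_cong_lists[OF assms(2)]
  by (auto intro: pres_cong.trans)

lemma pres_mult_class:
  assumes "u \<in> lists (X \<times> UNIV)" "v \<in> lists (X \<times> UNIV)"
  shows "pres_cong X R `` {u} \<otimes>\<^bsub>pres_group X R\<^esub> pres_cong X R `` {v} = pres_cong X R `` {u @ v}"
proof -
  have "pres_cong X R `` {a @ b} = pres_cong X R `` {u @ v}"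
    if "(u, a) \<in> pres_cong X R" "(v, b) \<in> pres_cong X R" for a b
    using equiv_class_eq[OF equiv_pres_cong pres_cong_append[OF that]] by simp
  then have "(\<Union>a\<in>pres_cong X R `` {u}. \<Union>b\<in>pres_cong X R `` {v}. pres_cong X R `` {a @ b})
      = (\<Union>a\<in>pres_cong X R `` {u}. \<Union>b\<in>pres_cong X R `` {v}. pres_cong X R `` {u @ v})"
    by (intro SUP_cong refl) auto
  also have "\<dots> = pres_cong X R `` {u @ v}"
    using pres_cong.refl[OF assms(1), of R] pres_cong.refl[OF assms(2), of R] by blast
  finally show ?thesis by (simp add: pres_group_def)
qed

lemma carrier_pres_group:
  "A \<in> carrier (pres_group X R) \<longleftrightarrow> (\<exists>w\<in>lists (X \<times> UNIV). A = pres_cong X R `` {w})"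
  by (auto simp: pres_group_def quotient_def)

lemma one_pres_group: "\<one>\<^bsub>pres_group X R\<^esub> = pres_cong X R `` {[]}"
  by (simp add: pres_group_def)

lemma pres_inverse_word:
  assumes "w \<in> lists (X \<times> UNIV)"
  shows "\<exists>w'\<in>lists (X \<times> UNIV). (w' @ w, []) \<in> pres_cong X R"
  using assms
proof (induction w)
  case Nil
  have "([] @ [], []) \<in> pres_cong X R" using pres_cong.refl[of "[]"] by simp
  then show ?case by blast
next
  case (Cons a w)
  then obtain w' where w': "w' \<in> lists (X \<times> UNIV)" "(w' @ w, []) \<in> pres_cong X R" by blast
  obtain x b where a: "a = (x, b)" by force
  have "(w' @ [(x, \<not> b), (x, \<not> \<not> b)] @ w, w' @ w) \<in> pres_cong X R"
    using Cons w' a by (intro pres_cong.cancel) auto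
  then have "((w' @ [(x, \<not> b)]) @ a # w, []) \<in> pres_cong X R"
    using w' a by (auto intro: pres_cong.trans)
  moreover have "w' @ [(x, \<not> b)] \<in> lists (X \<times> UNIV)" using Cons w' a by auto
  ultimately show ?case by blast
qed

lemma group_pres_group: "group (pres_group X R)"
proof (rule groupI)
  fix A assume "A \<in> carrier (pres_group X R)"
  then obtain w where w: "w \<in> lists (X \<times> UNIV)" "A = pres_cong X R `` {w}"
    by (auto simp: carrier_pres_group)
  then obtain w' where w': "w' \<in> lists (X \<times> UNIV)" "(w' @ w, []) \<in> pres_cong X R"
    using pres_inverse_word by blast
  have "pres_cong X R `` {w' @ w} = pres_cong X R `` {[]}"
    by (rule equiv_class_eq[OF equiv_pres_cong w'(2)])
  then show "\<exists>B\<in>carrier (pres_group X R). B \<otimes>\<^bsub>pres_group X R\<^esub> A = \<one>\<^bsub>pres_group X R\<^esub>"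
    using w w'(1)
    by (intro bexI[of _ "pres_cong X R `` {w'}"])
      (auto simp only: carrier_pres_group pres_mult_class one_pres_group)
next
  fix A B assume "A \<in> carrier (pres_group X R)" "B \<in> carrier (pres_group X R)"
  then obtain u v where "u \<in> lists (X \<times> UNIV)" "v \<in> lists (X \<times> UNIV)"
    "A = pres_cong X R `` {u}" "B = pres_cong X R `` {v}"
    unfolding carrier_pres_group by blast
  then show "A \<otimes>\<^bsub>pres_group X R\<^esub> B \<in> carrier (pres_group X R)"
    unfolding carrier_pres_group
    by (intro bexI[of _ "u @ v"]) (simp_all add: pres_mult_class)
next
  fix A B C
  assume "A \<in> carrier (pres_group X R)" "B \<in> carrier (pres_group X R)"
    "C \<in> carrier (pres_group X R)"
  then obtain u v w where "u \<in> lists (X \<times> UNIV)" "v \<in> lists (X \<times> UNIV)" "w \<in> lists (X \<times> UNIV)"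
    "A = pres_cong X R `` {u}" "B = pres_cong X R `` {v}" "C = pres_cong X R `` {w}"
    unfolding carrier_pres_group by blast
  then show "A \<otimes>\<^bsub>pres_group X R\<^esub> B \<otimes>\<^bsub>pres_group X R\<^esub> C
      = A \<otimes>\<^bsub>pres_group X R\<^esub> (B \<otimes>\<^bsub>pres_group X R\<^esub> C)"
    by (simp add: pres_mult_class)
next
  show "\<one>\<^bsub>pres_group X R\<^esub> \<in> carrier (pres_group X R)"
    unfolding carrier_pres_group one_pres_group by (intro bexI[of _ "[]"]) simp_all
next
  fix A assume "A \<in> carrier (pres_group X R)"
  then obtain u where "u \<in> lists (X \<times> UNIV)" "A = pres_cong X R `` {u}"
    unfolding carrier_pres_group by blast
  then show "\<one>\<^bsub>pres_group X R\<^esub> \<otimes>\<^bsub>pres_group X R\<^esub> A = A"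
    using pres_mult_class[of "[]" X u R] by (simp add: one_pres_group)
qed

lemma pres_gen_closed: "x \<in> X \<Longrightarrow> pres_gen X R x \<in> carrier (pres_group X R)"
  unfolding carrier_pres_group pres_gen_def by (intro bexI[of _ "[(x, True)]"]) auto

lemma gword_eval_closed:
  assumes "group G" "f \<in> X \<rightarrow> carrier G" "w \<in> lists (X \<times> UNIV)"
  shows "gword_eval G f w \<in> carrier G"
proof -
  interpret group G by fact
  show ?thesis using assms(3,2) by (induction w) (auto simp: Pi_iff)
qed

lemma gword_eval_append:
  assumes "group G" "f \<in> X \<rightarrow> carrier G" "u \<in> lists (X \<times> UNIV)" "v \<in> lists (X \<times> UNIV)"
  shows "gword_eval G f (u @ v) = gword_eval G f u \<otimes>\<^bsub>G\<^esub> gword_eval G f v"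
proof -
  interpret group G by fact
  note closed = gword_eval_closed[OF assms(1,2)]
  show ?thesis using assms(3)
  proof (induction u)
    case Nil then show ?case using closed[OF assms(4)] by simp
  next
    case (Cons a u)
    then have "f (fst a) \<in> carrier G" using assms(2) by auto
    then show ?case using Cons closed[OF assms(4)] closed[of u] by (auto simp: m_assoc)
  qed
qed

lemma gword_eval_cong:
  assumes G: "group G" and f: "f \<in> X \<rightarrow> carrier G"
    and R: "\<And>l r. (l, r) \<in> R \<Longrightarrow> gword_eval G f l = gword_eval G f r"
    and uv: "(u, v) \<in> pres_cong X R"
  shows "gword_eval G f u = gword_eval G f v"
proof -
  interpret group G by fact
  note closed = gword_eval_closed[OF G f] and app = gword_eval_append[OF G f]
  show ?thesis using uv
  proof (induction rule: pres_cong.induct)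
    case (cancel x u v b)
    have fx: "f x \<in> carrier G" using cancel f by auto
    have 1: "gword_eval G f [(x, b), (x, \<not> b)] = \<one>\<^bsub>G\<^esub>" using fx by (cases b) auto
    have 2: "[(x, b), (x, \<not> b)] \<in> lists (X \<times> UNIV)" using cancel by simp
    have "gword_eval G f (u @ [(x, b), (x, \<not> b)] @ v)
        = gword_eval G f u \<otimes>\<^bsub>G\<^esub> (gword_eval G f [(x, b), (x, \<not> b)] \<otimes>\<^bsub>G\<^esub> gword_eval G f v)"
      using app[of u "[(x, b), (x, \<not> b)] @ v"] app[OF 2 cancel(3)] cancel 2
      by (metis append_in_lists_conv)
    then show ?case using 1 closed[OF cancel(3)] app[OF cancel(2,3)] by simp
  next
    case (rel l r u v)
    then show ?case using R[OF rel(1)] by (simp add: app)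
  qed auto
qed

lemma pres_lift_class:
  assumes "group G" "f \<in> X \<rightarrow> carrier G"
    and "\<And>l r. (l, r) \<in> R \<Longrightarrow> gword_eval G f l = gword_eval G f r"
    and w: "w \<in> lists (X \<times> UNIV)"
  shows "pres_lift G f (pres_cong X R `` {w}) = gword_eval G f w"
proof -
  have "gword_eval G f ` (pres_cong X R `` {w}) = {gword_eval G f w}"
  proof (intro equalityI subsetI)
    fix y assume "y \<in> gword_eval G f ` (pres_cong X R `` {w})"
    then obtain v where v: "(w, v) \<in> pres_cong X R" "y = gword_eval G f v" by blast
    show "y \<in> {gword_eval G f w}"
      using gword_eval_cong[OF assms(1,2) _ v(1)] assms(3) v(2) by simp
  next
    fix y assume "y \<in> {gword_eval G f w}"
    then show "y \<in> gword_eval G f ` (pres_cong X R `` {w})"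
      using pres_cong.refl[OF w, of R] by blast
  qed
  then show ?thesis by (simp add: pres_lift_def)
qed

lemma pres_lift_hom:
  assumes "group G" "f \<in> X \<rightarrow> carrier G"
    and "\<And>l r. (l, r) \<in> R \<Longrightarrow> gword_eval G f l = gword_eval G f r"
  shows "pres_lift G f \<in> hom (pres_group X R) G"
proof (rule homI)
  have lift: "pres_lift G f (pres_cong X R `` {w}) = gword_eval G f w"
    if "w \<in> lists (X \<times> UNIV)" for w
    using pres_lift_class[OF assms(1,2) _ that] assms(3) by blast
  fix A assume "A \<in> carrier (pres_group X R)"
  then obtain w where w: "w \<in> lists (X \<times> UNIV)" "A = pres_cong X R `` {w}"
    unfolding carrier_pres_group by blast
  show "pres_lift G f A \<in> carrier G"
    using lift[OF w(1)] gword_eval_closed[OF assms(1,2) w(1)] w(2) by simp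
  fix B assume "B \<in> carrier (pres_group X R)"
  then obtain u v where "u \<in> lists (X \<times> UNIV)" "v \<in> lists (X \<times> UNIV)"
    "A = pres_cong X R `` {u}" "B = pres_cong X R `` {v}"
    using \<open>A \<in> _\<close> unfolding carrier_pres_group by blast
  then show "pres_lift G f (A \<otimes>\<^bsub>pres_group X R\<^esub> B) = pres_lift G f A \<otimes>\<^bsub>G\<^esub> pres_lift G f B"
    by (simp add: pres_mult_class lift gword_eval_append[OF assms(1,2)])
qed

lemma pres_lift_gen:
  assumes "group G" "f \<in> X \<rightarrow> carrier G"
    and "\<And>l r. (l, r) \<in> R \<Longrightarrow> gword_eval G f l = gword_eval G f r"
    and "x \<in> X"
  shows "pres_lift G f (pres_gen X R x) = f x"
proof -
  interpret group G by fact
  have "f x \<in> carrier G" using assms by auto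
  then show ?thesis unfolding pres_gen_def using assms(4)
    by (subst pres_lift_class[OF assms(1-3)]) auto
qed


section \<open>Quandles and adjoint groups\<close>

locale quandle =
  fixes X :: "'x set" and op :: "'x \<Rightarrow> 'x \<Rightarrow> 'x"
  assumes closed: "x \<in> X \<Longrightarrow> y \<in> X \<Longrightarrow> op x y \<in> X"
    and idem: "x \<in> X \<Longrightarrow> op x x = x"
    and self_distrib: "x \<in> X \<Longrightarrow> y \<in> X \<Longrightarrow> z \<in> X \<Longrightarrow> op (op x y) z = op (op x z) (op y z)"
    and bij: "y \<in> X \<Longrightarrow> bij_betw (\<lambda>x. op x y) X X"

definition conj_op :: "('g, 'm) monoid_scheme \<Rightarrow> 'g \<Rightarrow> 'g \<Rightarrow> 'g" where
  "conj_op G x y = inv\<^bsub>G\<^esub> y \<otimes>\<^bsub>G\<^esub> x \<otimes>\<^bsub>G\<^esub> y"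

definition adjoint_rels :: "'x set \<Rightarrow> ('x \<Rightarrow> 'x \<Rightarrow> 'x) \<Rightarrow> ('x gword \<times> 'x gword) set" where
  "adjoint_rels X op =
    {([(op x y, True)], [(y, False), (x, True), (y, True)]) | x y. x \<in> X \<and> y \<in> X}"

definition adjoint_group :: "'x set \<Rightarrow> ('x \<Rightarrow> 'x \<Rightarrow> 'x) \<Rightarrow> 'x gword set monoid" where
  "adjoint_group X op = pres_group X (adjoint_rels X op)"

definition adjoint_gen :: "'x set \<Rightarrow> ('x \<Rightarrow> 'x \<Rightarrow> 'x) \<Rightarrow> 'x \<Rightarrow> 'x gword set" where
  "adjoint_gen X op x = pres_gen X (adjoint_rels X op) x"


section \<open>Coxeter systems and Coxeter quandles\<close>

text \<open>
  The value \<open>0\<close> is not excluded for \<open>m s t\<close>; it yields the empty relation, exactly as \<open>\<infinity>\<close> does.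
\<close>

definition coxeter_system :: "'s set \<Rightarrow> ('s \<Rightarrow> 's \<Rightarrow> enat) \<Rightarrow> bool" where
  "coxeter_system S m \<longleftrightarrow>
    (\<forall>s\<in>S. \<forall>t\<in>S. m s t = m t s \<and> (m s t = 1 \<longleftrightarrow> s = t))"

definition coxeter_rels :: "'s set \<Rightarrow> ('s \<Rightarrow> 's \<Rightarrow> enat) \<Rightarrow> ('s gword \<times> 's gword) set" where
  "coxeter_rels S m =
    {(concat (replicate n [(s, True), (t, True)]), []) | s t n.
      s \<in> S \<and> t \<in> S \<and> m s t = enat n}"

definition coxeter_group :: "'s set \<Rightarrow> ('s \<Rightarrow> 's \<Rightarrow> enat) \<Rightarrow> 's gword set monoid" where
  "coxeter_group S m = pres_group S (coxeter_rels S m)"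

definition coxeter_gen :: "'s set \<Rightarrow> ('s \<Rightarrow> 's \<Rightarrow> enat) \<Rightarrow> 's \<Rightarrow> 's gword set" where
  "coxeter_gen S m s = pres_gen S (coxeter_rels S m) s"

definition coxeter_quandle :: "'s set \<Rightarrow> ('s \<Rightarrow> 's \<Rightarrow> enat) \<Rightarrow> 's gword set set" where
  "coxeter_quandle S m =
    {conj_op (coxeter_group S m) (coxeter_gen S m s) w | w s.
      w \<in> carrier (coxeter_group S m) \<and> s \<in> S}"

definition coxeter_conjugate :: "'s set \<Rightarrow> ('s \<Rightarrow> 's \<Rightarrow> enat) \<Rightarrow> 's \<Rightarrow> 's \<Rightarrow> bool" where
  "coxeter_conjugate S m s t \<longleftrightarrow>
    (\<exists>w\<in>carrier (coxeter_group S m).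
      conj_op (coxeter_group S m) (coxeter_gen S m s) w = coxeter_gen S m t)"

definition complete_reps :: "'s set \<Rightarrow> ('s \<Rightarrow> 's \<Rightarrow> enat) \<Rightarrow> 's set \<Rightarrow> bool" where
  "complete_reps S m R \<longleftrightarrow> R \<subseteq> S \<and> (\<forall>s\<in>S. \<exists>!r. r \<in> R \<and> coxeter_conjugate S m s r)"

definition coxeter_adjoint :: "'s set \<Rightarrow> ('s \<Rightarrow> 's \<Rightarrow> enat) \<Rightarrow> 's gword set gword set monoid" where
  "coxeter_adjoint S m = adjoint_group (coxeter_quandle S m) (conj_op (coxeter_group S m))"

definition coxeter_adjoint_gen ::
    "'s set \<Rightarrow> ('s \<Rightarrow> 's \<Rightarrow> enat) \<Rightarrow> 's gword set \<Rightarrow> 's gword set gword set" where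
  "coxeter_adjoint_gen S m x =
    adjoint_gen (coxeter_quandle S m) (conj_op (coxeter_group S m)) x"

definition coxeter_phi ::
    "'s set \<Rightarrow> ('s \<Rightarrow> 's \<Rightarrow> enat) \<Rightarrow> 's gword set gword set \<Rightarrow> 's gword set" where
  "coxeter_phi S m = pres_lift (coxeter_group S m) (\<lambda>x. x)"

lemma group_coxeter_group: "group (coxeter_group S m)"
  by (simp add: coxeter_group_def group_pres_group)

lemma coxeter_gen_closed: "s \<in> S \<Longrightarrow> coxeter_gen S m s \<in> carrier (coxeter_group S m)"
  by (simp add: coxeter_gen_def coxeter_group_def pres_gen_closed)

lemma coxeter_quandle_carrier: "coxeter_quandle S m \<subseteq> carrier (coxeter_group S m)"
proof -
  interpret group "coxeter_group S m" by (rule group_coxeter_group)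
  show ?thesis by (auto simp: coxeter_quandle_def conj_op_def coxeter_gen_closed)
qed

lemma (in group) conj_op_mult:
  assumes "x \<in> carrier G" "v \<in> carrier G" "w \<in> carrier G"
  shows "conj_op G (conj_op G x v) w = conj_op G x (v \<otimes> w)"
  using assms by (simp add: conj_op_def inv_mult_group m_assoc)

lemma (in group) conj_closed_quandle:
  assumes X: "X \<subseteq> carrier G"
    and conj: "\<And>x y. x \<in> X \<Longrightarrow> y \<in> carrier G \<Longrightarrow> conj_op G x y \<in> X"
  shows "quandle X (conj_op G)"
proof
  fix x y assume "x \<in> X" "y \<in> X"
  then show "conj_op G x y \<in> X" using X conj by blast
next
  fix x assume "x \<in> X"
  then show "conj_op G x x = x" using X by (auto simp: conj_op_def)
next
  fix x y z assume "x \<in> X" "y \<in> X" "z \<in> X"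
  then have *: "x \<in> carrier G" "y \<in> carrier G" "z \<in> carrier G" using X by auto
  then have "z \<otimes> conj_op G y z = y \<otimes> z"
    by (simp add: conj_op_def m_assoc[symmetric])
  moreover have "conj_op G y z \<in> carrier G" using * by (simp add: conj_op_def)
  ultimately show "conj_op G (conj_op G x y) z = conj_op G (conj_op G x z) (conj_op G y z)"
    using * by (simp add: conj_op_mult)
next
  fix y assume "y \<in> X"
  then have y: "y \<in> carrier G" using X by auto
  have one: "conj_op G x \<one> = x" if "x \<in> X" for x
    using that X by (auto simp: conj_op_def)
  show "bij_betw (\<lambda>x. conj_op G x y) X X"
    by (rule bij_betwI[where g = "\<lambda>x. conj_op G x (inv y)"])
      (use X y conj one in \<open>auto simp: conj_op_mult subset_iff\<close>)
qed

lemma quandle_coxeter_quandle: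
  "quandle (coxeter_quandle S m) (conj_op (coxeter_group S m))"
proof -
  interpret group "coxeter_group S m" by (rule group_coxeter_group)
  show ?thesis
  proof (rule conj_closed_quandle[OF coxeter_quandle_carrier])
    fix x y assume x: "x \<in> coxeter_quandle S m" and y: "y \<in> carrier (coxeter_group S m)"
    from x obtain w s where *: "x = conj_op (coxeter_group S m) (coxeter_gen S m s) w"
      "w \<in> carrier (coxeter_group S m)" "s \<in> S" by (auto simp: coxeter_quandle_def)
    then have "conj_op (coxeter_group S m) x y
        = conj_op (coxeter_group S m) (coxeter_gen S m s) (w \<otimes>\<^bsub>coxeter_group S m\<^esub> y)"
      using y by (simp add: conj_op_mult coxeter_gen_closed)
    then show "conj_op (coxeter_group S m) x y \<in> coxeter_quandle S m"
      using * y unfolding coxeter_quandle_def by blast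
  qed
qed

lemma coxeter_phi:
  "coxeter_phi S m \<in> hom (coxeter_adjoint S m) (coxeter_group S m)"
  "x \<in> coxeter_quandle S m \<Longrightarrow> coxeter_phi S m (coxeter_adjoint_gen S m x) = x"
proof -
  interpret group "coxeter_group S m" by (rule group_coxeter_group)
  have f: "(\<lambda>x. x) \<in> coxeter_quandle S m \<rightarrow> carrier (coxeter_group S m)"
    using coxeter_quandle_carrier by auto
  have R: "gword_eval (coxeter_group S m) (\<lambda>x. x) l = gword_eval (coxeter_group S m) (\<lambda>x. x) r"
    if "(l, r) \<in> adjoint_rels (coxeter_quandle S m) (conj_op (coxeter_group S m))" for l r
    using that coxeter_quandle_carrier[of S m]
    by (auto simp: adjoint_rels_def conj_op_def m_assoc subset_iff)
  show "coxeter_phi S m \<in> hom (coxeter_adjoint S m) (coxeter_group S m)"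
    unfolding coxeter_phi_def coxeter_adjoint_def adjoint_group_def
    by (rule pres_lift_hom[OF group_coxeter_group f R])
  show "coxeter_phi S m (coxeter_adjoint_gen S m x) = x" if "x \<in> coxeter_quandle S m"
    unfolding coxeter_phi_def coxeter_adjoint_gen_def adjoint_gen_def
    by (rule pres_lift_gen[OF group_coxeter_group f R that])
qed


section \<open>Abelianizations in coordinates\<close>

definition abelianization :: "('g, 'm) monoid_scheme \<Rightarrow> 'g set monoid" where
  "abelianization G = G Mod (derived G (carrier G))"

definition ab_class :: "('g, 'm) monoid_scheme \<Rightarrow> 'g \<Rightarrow> 'g set" where
  "ab_class G g = derived G (carrier G) #>\<^bsub>G\<^esub> g"

text \<open>
  Let \<open>K\<close> be the additive group of the integers or of the integers mod \<open>n\<close> (with representatives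
  \<open>0, \<dots>, n - 1\<close>). If the classes of \<open>b i\<close> (\<open>i \<in> I\<close>) form a basis of the abelianization of \<open>G\<close>
  over \<open>K\<close>, then \<open>ab_comb G I b\<close> (integer combinations, written multiplicatively) is an
  isomorphism from the direct sum of copies of \<open>K\<close>, and \<open>ab_coords G K I b\<close> is the
  abelianization map followed by the inverse of that isomorphism.
\<close>

definition ab_comb :: "('g, 'm) monoid_scheme \<Rightarrow> 'i set \<Rightarrow> ('i \<Rightarrow> 'g) \<Rightarrow> ('i \<Rightarrow> int) \<Rightarrow> 'g set" where
  "ab_comb G I b c =
    gfinprod (abelianization G) (\<lambda>i. ab_class G (b i) [^]\<^bsub>abelianization G\<^esub> c i) I"

definition ab_coords ::
    "('g, 'm) monoid_scheme \<Rightarrow> int monoid \<Rightarrow> 'i set \<Rightarrow> ('i \<Rightarrow> 'g) \<Rightarrow> 'g \<Rightarrow> ('i \<Rightarrow> int)" where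
  "ab_coords G K I b g =
    inv_into (carrier (sum_group I (\<lambda>_. K))) (ab_comb G I b) (ab_class G g)"

definition reduce_mod2 :: "'i set \<Rightarrow> ('i \<Rightarrow> int) \<Rightarrow> ('i \<Rightarrow> int)" where
  "reduce_mod2 I c = (\<lambda>i\<in>I. c i mod 2)"


section \<open>Pullback squares of groups\<close>

text \<open>
  The square with corner \<open>P\<close>, projections \<open>p: P \<rightarrow> A\<close>, \<open>q: P \<rightarrow> B\<close> and maps \<open>f: A \<rightarrow> C\<close>,
  \<open>g: B \<rightarrow> C\<close> has the universal property of a pullback with respect to all test groups with
  elements in the type \<open>'t\<close>. The type argument is needed because HOL cannot quantify over types;
  a theorem that leaves \<open>'t\<close> free covers all test groups. Homomorphisms are compared on
  carriers only, hence the restriction to extensional functions in the uniqueness claim.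
\<close>

definition pullback_square ::
    "'t itself \<Rightarrow> ('p, 'm1) monoid_scheme \<Rightarrow> ('a, 'm2) monoid_scheme \<Rightarrow>
     ('b, 'm3) monoid_scheme \<Rightarrow> ('c, 'm4) monoid_scheme \<Rightarrow>
     ('p \<Rightarrow> 'a) \<Rightarrow> ('p \<Rightarrow> 'b) \<Rightarrow> ('a \<Rightarrow> 'c) \<Rightarrow> ('b \<Rightarrow> 'c) \<Rightarrow> bool" where
  "pullback_square (_ :: 't itself) P A B C p q f g \<longleftrightarrow>
    group P \<and> group A \<and> group B \<and> group C \<and>
    p \<in> hom P A \<and> q \<in> hom P B \<and> f \<in> hom A C \<and> g \<in> hom B C \<and>
    (\<forall>x\<in>carrier P. f (p x) = g (q x)) \<and>
    (\<forall>(T :: 't monoid) h k.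
      group T \<and> h \<in> hom T A \<and> k \<in> hom T B \<and> (\<forall>t\<in>carrier T. f (h t) = g (k t)) \<longrightarrow>
      (\<exists>!u. u \<in> hom T P \<and> u \<in> extensional (carrier T) \<and>
        (\<forall>t\<in>carrier T. p (u t) = h t \<and> q (u t) = k t)))"

end

theory Submission
  imports Defs
begin

text \<open>
  Write \<open>W\<close> for the Coxeter group, \<open>A\<close> for the adjoint group of its quandle \<open>X\<close> of reflections,
  \<open>e x\<close> for the generators of \<open>A\<close> and \<open>\<phi>: A \<rightarrow> W\<close> for the map \<open>e x \<mapsto> x\<close>. The square is a pullback
  iff each pair \<open>(c, w)\<close> of elements with the same image in \<open>(\<int>/2)\<^sup>R\<close> comes from exactly one
  element of \<open>A\<close> (\<open>pullback_squareI\<close>), so the task is to compare the kernels of the two vertical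
  maps.

  The horizontal maps are first made explicit. The presentation of \<open>A\<close> yields a homomorphism
  \<open>D: A \<rightarrow> \<int>\<^sup>R\<close> that sends \<open>e x\<close> to the basis vector of the conjugacy class of \<open>x\<close>. The
  presentation of \<open>W\<close> yields the analogous map to \<open>(\<int>/2)\<^sup>R\<close>: two generators \<open>s\<close>, \<open>t\<close> with
  \<open>m s t\<close> odd are conjugate, so every Coxeter relation holds in the target. Both maps are the
  abelianization in coordinates, because each group is generated by conjugates of the elements
  that index the basis (\<open>ab_coords_eq\<close>).

  The heart is that \<open>\<phi>\<close> has a central kernel generated by the squares \<open>(e r)\<^sup>2\<close>, \<open>r \<in> R\<close>.
  Conjugation in \<open>A\<close> acts on the generators through \<open>\<phi>\<close> (\<open>conj_e\<close>), so an element of the kernel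
  commutes with all generators (\<open>ker_phi_central\<close>). Let \<open>N\<close> be the group generated by the squares.
  In \<open>A/N\<close> the images of the \<open>e s\<close>, \<open>s \<in> S\<close>, are involutions, and for two involutions
  the relation \<open>(ab)\<^sup>n = 1\<close> is equivalent to a statement about the conjugate of \<open>a\<close> by a power of
  \<open>ab\<close> (\<open>involutions_pow_eq_one_iff\<close>). Such a statement passes from \<open>W\<close> to \<open>A\<close> by \<open>conj_e\<close>.
  Hence the Coxeter relations hold in \<open>A/N\<close>, the quotient map \<open>A \<rightarrow> A/N\<close> factors through \<open>\<phi>\<close>, and
  the kernel of \<open>\<phi>\<close> is \<open>N\<close> (\<open>ker_phi_subset_squares\<close>).

  Finally \<open>D\<close> sends \<open>(e r)\<^sup>2\<close> to twice the basis vector of \<open>r\<close>. It therefore maps the kernel of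
  \<open>\<phi>\<close> bijectively onto \<open>2\<int>\<^sup>R\<close>, the kernel of reduction mod 2; as \<open>\<phi>\<close> is surjective, this
  gives the unique existence claim (\<open>square_bijective\<close>).
\<close>

section \<open>Homomorphisms, conjugation and generating sets\<close>

lemma hom_eq_on_generate:
  assumes G: "group G" and H: "group H" and f: "f \<in> hom G H" and g: "g \<in> hom G H"
    and T: "T \<subseteq> carrier G" and eq: "\<And>t. t \<in> T \<Longrightarrow> f t = g t"
    and x: "x \<in> generate G T"
  shows "f x = g x"
proof -
  interpret f: group_hom G H f by (intro group_hom.intro group_hom_axioms.intro G H f)
  interpret g: group_hom G H g by (intro group_hom.intro group_hom_axioms.intro G H g)
  show ?thesis using x
  proof (induction rule: generate.induct)
    case one then show ?case by simp
  next
    case (incl h) then show ?case by (rule eq)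
  next
    case (inv h) then show ?case using T eq[of h] by (auto simp: subset_iff)
  next
    case (eng h1 h2)
    then have "h1 \<in> carrier G" "h2 \<in> carrier G" using f.G.generate_in_carrier[OF T] by auto
    then show ?case using eng by simp
  qed
qed

lemma generate_subset_hom_image:
  assumes "group G" "group H" "h \<in> hom G H" "subgroup K G" "T \<subseteq> h ` K"
  shows "generate H T \<subseteq> h ` K"
proof -
  interpret group_hom G H h by (intro group_hom.intro group_hom_axioms.intro assms)
  show ?thesis
    by (rule H.generate_subgroup_incl[OF assms(5) subgroup_img_is_subgroup[OF assms(4)]])
qed

lemma (in group) conj_op_closed [simp]:
  "x \<in> carrier G \<Longrightarrow> g \<in> carrier G \<Longrightarrow> conj_op G x g \<in> carrier G"
  by (simp add: conj_op_def)

lemma (in group) conj_op_hom: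
  assumes g: "g \<in> carrier G" shows "(\<lambda>x. conj_op G x g) \<in> hom G G"
proof (rule homI)
  fix x y assume xy: "x \<in> carrier G" "y \<in> carrier G"
  have "inv g \<otimes> x \<otimes> g \<otimes> (inv g \<otimes> y \<otimes> g) = inv g \<otimes> x \<otimes> (g \<otimes> inv g) \<otimes> y \<otimes> g"
    using g xy by (simp only: m_assoc inv_closed m_closed)
  then show "conj_op G (x \<otimes> y) g = conj_op G x g \<otimes> conj_op G y g"
    using g xy by (simp add: conj_op_def m_assoc)
qed (use g in simp)

lemma (in group) conj_op_one [simp]: "x \<in> carrier G \<Longrightarrow> conj_op G x \<one> = x"
  by (simp add: conj_op_def)

lemma (in group) conj_op_cancel [simp]:
  assumes "x \<in> carrier G" "g \<in> carrier G"
  shows "conj_op G (conj_op G x g) (inv g) = x" "conj_op G (conj_op G x (inv g)) g = x"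
  using assms by (simp_all add: conj_op_mult)

lemma (in group) conj_op_fixed_iff:
  assumes "x \<in> carrier G" "g \<in> carrier G"
  shows "conj_op G x g = x \<longleftrightarrow> x \<otimes> g = g \<otimes> x"
  using assms by (simp add: conj_op_def m_assoc inv_solve_left')

lemma (in comm_group) conj_op_trivial:
  "x \<in> carrier G \<Longrightarrow> g \<in> carrier G \<Longrightarrow> conj_op G x g = x"
  by (simp add: conj_op_fixed_iff m_comm)

lemma (in group_hom) hom_conj_op:
  "x \<in> carrier G \<Longrightarrow> g \<in> carrier G \<Longrightarrow> h (conj_op G x g) = conj_op H (h x) (h g)"
  by (simp add: conj_op_def)

text \<open>
  In the dihedral group generated by two involutions, \<open>a\<close> inverts \<open>ab\<close>, so conjugating \<open>a\<close> by
  \<open>(ab)\<^sup>k\<close> moves both powers to the same side.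
\<close>
lemma (in group) involutions_conj_pow:
  assumes a: "a \<in> carrier G" "a \<otimes> a = \<one>" and b: "b \<in> carrier G" "b \<otimes> b = \<one>"
  shows "conj_op G a ((a \<otimes> b) [^] (k::nat)) = a \<otimes> (a \<otimes> b) [^] (k + k)"
proof -
  let ?p = "a \<otimes> b"
  have p: "?p \<in> carrier G" using a b by simp
  \<comment> \<open>This is \<open>a p\<^sup>k a = p\<^sup>-\<^sup>k\<close> in a form without inverses, which suits the induction.\<close>
  have key: "?p [^] k \<otimes> a \<otimes> ?p [^] k = a"
  proof (induction k)
    case 0 then show ?case using a by simp
  next
    case (Suc k)
    have "?p \<otimes> a \<otimes> ?p = a \<otimes> (b \<otimes> (a \<otimes> a) \<otimes> b)" using a(1) b(1) by (simp add: m_assoc)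
    then have "?p \<otimes> a \<otimes> ?p = a" using a b by simp
    moreover have "?p [^] k \<otimes> ?p \<otimes> a \<otimes> (?p \<otimes> ?p [^] k) = ?p [^] k \<otimes> (?p \<otimes> a \<otimes> ?p) \<otimes> ?p [^] k"
      using p a(1) by (simp only: m_assoc m_closed nat_pow_closed)
    moreover have "?p \<otimes> ?p [^] k = ?p [^] Suc k" by (rule nat_pow_Suc2[OF p, symmetric])
    ultimately show ?case using Suc by (simp only: nat_pow_Suc)
  qed
  have "inv (?p [^] k) \<otimes> a = inv (?p [^] k) \<otimes> (?p [^] k \<otimes> a \<otimes> ?p [^] k)"
    by (simp only: key)
  also have "\<dots> = a \<otimes> ?p [^] k"
    using p a(1) by (simp add: m_assoc[symmetric])
  finally show ?thesis
    using p a(1) by (simp add: conj_op_def m_assoc nat_pow_mult)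
qed

text \<open>
  This turns a Coxeter relation into a statement about the conjugation action alone, which is what
  the adjoint group remembers. By \<open>involutions_conj_pow\<close> the conjugate equals \<open>a (ab)\<^sup>n\<close> for even
  \<open>n\<close> and \<open>a (ab)\<^sup>n (ab)\<close> for odd \<open>n\<close>, and \<open>a(ab) = b\<close>.
\<close>
lemma (in group) involutions_pow_eq_one_iff:
  fixes n :: nat
  assumes a: "a \<in> carrier G" "a \<otimes> a = \<one>" and b: "b \<in> carrier G" "b \<otimes> b = \<one>"
  shows "(a \<otimes> b) [^] n = \<one> \<longleftrightarrow>
    conj_op G a ((a \<otimes> b) [^] (Suc n div 2)) = (if even n then a else b)"
proof -
  let ?p = "a \<otimes> b"
  have p: "?p \<in> carrier G" using a b by simp
  show ?thesis
  proof (cases "even n")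
    case True
    then have "Suc n div 2 + Suc n div 2 = n" by presburger
    then show ?thesis
      using True involutions_conj_pow[OF a b, of "Suc n div 2"] a p by simp
  next
    case False
    then have "Suc n div 2 + Suc n div 2 = Suc n" by presburger
    then have "conj_op G a (?p [^] (Suc n div 2)) = a \<otimes> (?p [^] n \<otimes> ?p)"
      using involutions_conj_pow[OF a b, of "Suc n div 2"] by simp
    moreover have "a \<otimes> (?p [^] n \<otimes> ?p) = b \<longleftrightarrow> a \<otimes> (?p [^] n \<otimes> ?p) = a \<otimes> ?p"
      using a b by (simp add: m_assoc[symmetric])
    ultimately show ?thesis using False a p by simp
  qed
qed

lemma hom_into_comm_group_ker_derived:
  assumes "group G" "comm_group H" "h \<in> hom G H" "x \<in> derived G (carrier G)"
  shows "h x = \<one>\<^bsub>H\<^esub>"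
proof -
  interpret H: comm_group H by fact
  interpret group_hom G H h
    by (intro group_hom.intro group_hom_axioms.intro assms H.is_group)
  have "derived H (h ` carrier G) = h ` derived G (carrier G)" by (rule derived_img) simp
  moreover have "derived H (h ` carrier G) = {\<one>\<^bsub>H\<^esub>}"
    by (rule H.derived_eq_singleton) auto
  ultimately show ?thesis using assms(4) by blast
qed


section \<open>Direct sums of cyclic groups\<close>

text \<open>
  Since \<open>integer_mod_group 0\<close> is \<open>integer_group\<close>, the case \<open>n = 0\<close> is the free abelian group on
  \<open>I\<close>, and both right-hand corners of the square have this form.
\<close>
abbreviation cyclic_sum :: "nat \<Rightarrow> 'i set \<Rightarrow> ('i \<Rightarrow> int) monoid" where
  "cyclic_sum n I \<equiv> sum_group I (\<lambda>_. integer_mod_group n)"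

text \<open>The remainder \<open>1 mod int n\<close> is \<open>1\<close> except for \<open>n = 1\<close>, where the group is trivial.\<close>
definition basis_vec :: "nat \<Rightarrow> 'i set \<Rightarrow> 'i \<Rightarrow> 'i \<Rightarrow> int" where
  "basis_vec n I i = (\<lambda>j\<in>I. if j = i then 1 mod int n else 0)"

lemma integer_mod_group_zero: "integer_mod_group 0 = integer_group"
  by (simp add: integer_mod_group_def)

lemma carrier_cyclic_sum:
  "c \<in> carrier (cyclic_sum n I) \<longleftrightarrow>
    c \<in> extensional I \<and> (\<forall>i\<in>I. c i mod int n = c i) \<and> finite {i\<in>I. c i \<noteq> 0}"
proof -
  have "x \<in> carrier (integer_mod_group n) \<longleftrightarrow> x mod int n = x" for x
    by (cases "n = 0") (auto simp: carrier_integer_mod_group zmod_trivial_iff)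
  then show ?thesis by (auto simp: carrier_sum_group PiE_iff)
qed

lemma comm_group_cyclic_sum: "comm_group (cyclic_sum n I)"
proof -
  have "group (cyclic_sum n I)" by simp
  then show ?thesis by (rule group.group_comm_groupI) (simp only: mult_sum_group mult_integer_mod_group add.commute)
qed

lemma basis_vec_closed: "basis_vec n I i \<in> carrier (cyclic_sum n I)"
proof -
  have "finite {j \<in> I. basis_vec n I i j \<noteq> 0}"
    by (rule finite_subset[of _ "{i}"]) (auto simp: basis_vec_def)
  then show ?thesis by (auto simp: carrier_cyclic_sum basis_vec_def)
qed

lemma basis_vec_int_pow:
  "basis_vec n I i [^]\<^bsub>cyclic_sum n I\<^esub> (k::int) = (\<lambda>j\<in>I. if j = i then k mod int n else 0)"
proof -
  interpret group "cyclic_sum n I" by (rule sum_group) simp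
  have nat: "basis_vec n I i [^]\<^bsub>cyclic_sum n I\<^esub> (l::nat) = (\<lambda>j\<in>I. if j = i then int l mod int n else 0)" for l
    by (induction l) (auto simp: basis_vec_def fun_eq_iff mod_simps add.commute)
  show ?thesis
  proof (cases k)
    case (nonneg l)
    show ?thesis unfolding nonneg int_pow_int nat ..
  next
    case (neg l)
    have "basis_vec n I i [^]\<^bsub>cyclic_sum n I\<^esub> Suc l \<in> carrier (cyclic_sum n I)"
      by (rule nat_pow_closed[OF basis_vec_closed])
    then have c: "(\<lambda>j\<in>I. if j = i then int (Suc l) mod int n else 0) \<in> carrier (cyclic_sum n I)"
      unfolding nat .
    have "(\<lambda>j\<in>I. if j = i then k mod int n else 0) \<otimes>\<^bsub>cyclic_sum n I\<^esub>
        (\<lambda>j\<in>I. if j = i then int (Suc l) mod int n else 0) = \<one>\<^bsub>cyclic_sum n I\<^esub>"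
      unfolding mult_sum_group one_sum_group using neg
      by (intro restrict_ext) (simp add: mod_simps)
    moreover have "finite {j \<in> I. (\<lambda>j\<in>I. if j = i then k mod int n else 0) j \<noteq> 0}"
      by (rule finite_subset[of _ "{i}"]) auto
    then have "(\<lambda>j\<in>I. if j = i then k mod int n else 0) \<in> carrier (cyclic_sum n I)"
      unfolding carrier_cyclic_sum by simp
    ultimately have "inv\<^bsub>cyclic_sum n I\<^esub> (\<lambda>j\<in>I. if j = i then int (Suc l) mod int n else 0)
       = (\<lambda>j\<in>I. if j = i then k mod int n else 0)"
      by (rule inv_equality[OF _ c])
    then show ?thesis unfolding neg int_pow_neg_int[OF basis_vec_closed] nat .
  qed
qed

text \<open>
  An element of a direct sum has finite support, so the basis vectors generate; the induction
  removes one point of the support at a time.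
\<close>
lemma generate_basis_vec:
  "generate (cyclic_sum n I) (basis_vec n I ` I) = carrier (cyclic_sum n I)"
proof -
  interpret group "cyclic_sum n I" by (rule sum_group) simp
  let ?H = "generate (cyclic_sum n I) (basis_vec n I ` I)"
  have T: "basis_vec n I ` I \<subseteq> carrier (cyclic_sum n I)" by (intro image_subsetI basis_vec_closed)
  have sub: "subgroup ?H (cyclic_sum n I)" by (rule generate_is_subgroup[OF T])
  have mem: "c \<in> ?H" if "finite F" "c \<in> carrier (cyclic_sum n I)" "{i\<in>I. c i \<noteq> 0} \<subseteq> F" for F c
    using that
  proof (induction F arbitrary: c rule: finite_induct)
    case empty
    then have "c = \<one>\<^bsub>cyclic_sum n I\<^esub>"
      by (auto simp: carrier_cyclic_sum fun_eq_iff extensional_def)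
    then show ?case using subgroup.one_closed[OF sub] by (simp only:)
  next
    case (insert i F)
    show ?case
    proof (cases "i \<in> I")
      case False
      then show ?thesis using insert.IH[of c] insert.prems by blast
    next
      case True
      let ?c = "c(i := 0)"
      have "finite {j\<in>I. ?c j \<noteq> 0}"
        by (rule finite_subset[of _ "{j\<in>I. c j \<noteq> 0}"])
          (use insert.prems(1) in \<open>auto simp: carrier_cyclic_sum\<close>)
      then have "?c \<in> carrier (cyclic_sum n I)"
        using insert.prems(1) True unfolding carrier_cyclic_sum by (simp add: extensional_def)
      moreover have "{j\<in>I. ?c j \<noteq> 0} \<subseteq> F" using insert.prems(2) by auto
      ultimately have "?c \<in> ?H" by (rule insert.IH)
      moreover have "basis_vec n I i [^]\<^bsub>cyclic_sum n I\<^esub> c i \<in> ?H"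
        using group.int_pow_closed[OF subgroup_imp_group[OF sub], of "basis_vec n I i" "c i"]
          generate.incl[of "basis_vec n I i" "basis_vec n I ` I" "cyclic_sum n I"] True
          int_pow_consistent[OF sub]
        by simp
      moreover have "c = ?c \<otimes>\<^bsub>cyclic_sum n I\<^esub> (basis_vec n I i [^]\<^bsub>cyclic_sum n I\<^esub> c i)"
        using insert.prems(1) True
        by (auto simp: basis_vec_int_pow carrier_cyclic_sum fun_eq_iff extensional_def)
      ultimately show ?thesis using subgroup.m_closed[OF sub] by metis
    qed
  qed
  have "carrier (cyclic_sum n I) \<subseteq> ?H"
  proof
    fix c assume c: "c \<in> carrier (cyclic_sum n I)"
    then have "finite {i\<in>I. c i \<noteq> 0}" unfolding carrier_cyclic_sum by (elim conjE)
    then show "c \<in> ?H" by (rule mem[OF _ c order_refl])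
  qed
  then show ?thesis using subgroup.subset[OF sub] by (rule equalityI[rotated])
qed

lemma reduce_mod2_hom: "reduce_mod2 I \<in> hom (cyclic_sum 0 I) (cyclic_sum 2 I)"
proof (rule homI)
  fix c assume c: "c \<in> carrier (cyclic_sum 0 I)"
  have "{i \<in> I. reduce_mod2 I c i \<noteq> 0} \<subseteq> {i \<in> I. c i \<noteq> 0}"
    unfolding reduce_mod2_def using mod_0 by fastforce
  moreover have "finite {i \<in> I. c i \<noteq> 0}" using c unfolding carrier_cyclic_sum by (elim conjE)
  ultimately have "finite {i \<in> I. reduce_mod2 I c i \<noteq> 0}" by (rule finite_subset)
  then show "reduce_mod2 I c \<in> carrier (cyclic_sum 2 I)"
    unfolding carrier_cyclic_sum reduce_mod2_def
    by (simp only: of_nat_numeral restrict_apply' mod_mod_trivial restrict_extensional simp_thms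
        ball_triv cong: ball_cong)
next
  fix c d
  show "reduce_mod2 I (c \<otimes>\<^bsub>cyclic_sum 0 I\<^esub> d)
      = reduce_mod2 I c \<otimes>\<^bsub>cyclic_sum 2 I\<^esub> reduce_mod2 I d"
    unfolding reduce_mod2_def mult_sum_group mult_integer_mod_group
    by (rule restrict_ext) (simp only: restrict_apply' of_nat_0 of_nat_numeral mod_by_0 mod_add_eq)
qed

lemma reduce_mod2_basis_vec: "reduce_mod2 I (basis_vec 0 I i) = basis_vec 2 I i"
  unfolding reduce_mod2_def basis_vec_def
  by (rule restrict_ext) (simp only: restrict_apply' of_nat_0 of_nat_numeral mod_by_0 mod_0
      if_distrib[of "\<lambda>x. x mod 2"])

lemma (in group) int_pow_mod_exponent:
  assumes "x \<in> carrier G" "x [^] n = \<one>"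
  shows "x [^] (k mod int n) = x [^] (k::int)"
proof -
  have "x [^] k = x [^] (int n * (k div int n) + k mod int n)" by simp
  also have "\<dots> = (x [^] int n) [^] (k div int n) \<otimes> x [^] (k mod int n)"
    using assms(1) by (simp only: int_pow_mult int_pow_pow int_pow_closed)
  also have "\<dots> = x [^] (k mod int n)" using assms by (simp add: int_pow_int)
  finally show ?thesis by simp
qed

text \<open>
  The universal property of the direct sum. Its explicit form is the one in which
  \<open>ab_comb\<close> is defined; uniqueness of the lift is \<open>hom_eq_on_generate\<close> with
  \<open>generate_basis_vec\<close>.
\<close>
lemma (in comm_group) cyclic_sum_lift:
  fixes f :: "'i \<Rightarrow> 'a" and n :: nat
  assumes f: "f \<in> I \<rightarrow> carrier G" and n: "\<And>i. i \<in> I \<Longrightarrow> f i [^] n = \<one>"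
  defines "E \<equiv> (\<lambda>c. gfinprod G (\<lambda>i. f i [^] (c i :: int)) I)"
  shows "E \<in> hom (cyclic_sum n I) G" "\<And>i. i \<in> I \<Longrightarrow> E (basis_vec n I i) = f i"
proof -
  show "E \<in> hom (cyclic_sum n I) G" unfolding E_def
  proof (rule hom_group_sum)
    fix i assume i: "i \<in> I"
    then show "(\<lambda>k. f i [^] k) \<in> hom (integer_mod_group n) G"
      using f n int_pow_mod_exponent[of "f i" n]
      by (intro homI) (auto simp: int_pow_mult Pi_iff)
  qed simp
  fix i assume i: "i \<in> I"
  have fi: "f i \<in> carrier G" using f i by auto
  have "E (basis_vec n I i) = gfinprod G (\<lambda>j. f j [^] basis_vec n I i j) {i}"
    unfolding E_def
    by (rule gfinprod_mono_neutral_cong_right) (use i f in \<open>auto simp: basis_vec_def\<close>)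
  also have "\<dots> = f i [^] (1 mod int n)"
    using fi i by (simp add: basis_vec_def)
  also have "\<dots> = f i"
    using int_pow_mod_exponent[OF fi n[OF i], of 1] fi by simp
  finally show "E (basis_vec n I i) = f i" .
qed


section \<open>Abelianizations with a basis\<close>

text \<open>
  A recognition principle for abelianization coordinates. On the conjugates of the \<open>b i\<close> the maps
  \<open>ab_comb \<circ> D\<close> and \<open>ab_class\<close> agree, as both targets are abelian; these conjugates generate, so
  the two maps are equal. The map \<open>ab_comb\<close> is injective because \<open>D\<close> is surjective and
  factors through the abelianization.
\<close>
lemma ab_coords_eq:
  fixes n :: nat
  assumes G: "group G" and b: "b \<in> I \<rightarrow> carrier G"
    and D: "D \<in> hom G (cyclic_sum n I)" and Db: "\<And>i. i \<in> I \<Longrightarrow> D (b i) = basis_vec n I i"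
    and n: "\<And>i. i \<in> I \<Longrightarrow> b i [^]\<^bsub>G\<^esub> n = \<one>\<^bsub>G\<^esub>"
    and T: "generate G T = carrier G"
    and conj: "\<And>t. t \<in> T \<Longrightarrow> \<exists>i\<in>I. \<exists>g\<in>carrier G. t = conj_op G (b i) g"
    and g: "g \<in> carrier G"
  shows "ab_coords G (integer_mod_group n) I b g = D g"
proof -
  interpret group G by (rule G)
  let ?A = "abelianization G" and ?C = "cyclic_sum n I"
  interpret C: comm_group ?C by (rule comm_group_cyclic_sum)
  interpret A: comm_group ?A unfolding abelianization_def by (rule derived_quot_is_comm_group)
  have N: "derived G (carrier G) \<lhd> G" by (rule derived_self_is_normal)
  have cls: "ab_class G \<in> hom G ?A"
    unfolding ab_class_def[abs_def] abelianization_def by (rule normal.r_coset_hom_Mod[OF N])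
  interpret cls: group_hom G ?A "ab_class G" by unfold_locales (rule cls)
  interpret D: group_hom G ?C D by unfold_locales (rule D)
  have bi: "b i \<in> carrier G" if "i \<in> I" for i using b that by auto
  have f: "(\<lambda>i. ab_class G (b i)) \<in> I \<rightarrow> carrier ?A" using bi by auto
  have fn: "ab_class G (b i) [^]\<^bsub>?A\<^esub> n = \<one>\<^bsub>?A\<^esub>" if "i \<in> I" for i
    using cls.hom_nat_pow[OF bi[OF that], of n] n[OF that] by simp
  have comb: "ab_comb G I b \<in> hom ?C ?A"
    and comb_basis: "\<And>i. i \<in> I \<Longrightarrow> ab_comb G I b (basis_vec n I i) = ab_class G (b i)"
    using A.cyclic_sum_lift[OF f fn] by (simp_all add: ab_comb_def[abs_def])
  have TG: "T \<subseteq> carrier G" using conj bi by fastforce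
  have comb_D: "ab_comb G I b (D x) = ab_class G x" if "x \<in> carrier G" for x
  proof -
    have "(ab_comb G I b \<circ> D) x = ab_class G x"
    proof (rule hom_eq_on_generate[OF G A.is_group _ cls TG])
      show "ab_comb G I b \<circ> D \<in> hom G ?A" by (rule Group.hom_compose[OF D comb])
      show "x \<in> generate G T" using that T by simp
      fix t assume "t \<in> T"
      then obtain i y where i: "i \<in> I" "y \<in> carrier G" "t = conj_op G (b i) y" using conj by blast
      then have "D t = basis_vec n I i" "ab_class G t = ab_class G (b i)"
        using bi Db C.conj_op_trivial[OF basis_vec_closed D.hom_closed]
        by (simp_all add: D.hom_conj_op cls.hom_conj_op A.conj_op_trivial)
      then show "(ab_comb G I b \<circ> D) t = ab_class G t" using comb_basis i(1) by simp
    qed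
    then show ?thesis by simp
  qed
  have "basis_vec n I ` I \<subseteq> D ` carrier G"
  proof (rule image_subsetI)
    fix i assume "i \<in> I"
    then show "basis_vec n I i \<in> D ` carrier G" using Db[of i] bi[of i] by (metis imageI)
  qed
  then have "generate ?C (basis_vec n I ` I) \<subseteq> D ` carrier G"
    by (rule generate_subset_hom_image[OF G C.is_group D subgroup_self])
  then have surj: "carrier ?C \<subseteq> D ` carrier G" by (simp only: generate_basis_vec)
  have "inj_on (ab_comb G I b) (carrier ?C)"
  proof (rule inj_onI)
    fix c d assume c: "c \<in> carrier ?C" and d: "d \<in> carrier ?C"
      and eq: "ab_comb G I b c = ab_comb G I b d"
    obtain x where x: "c = D x" "x \<in> carrier G" using subsetD[OF surj c] by (rule imageE)
    obtain y where y: "d = D y" "y \<in> carrier G" using subsetD[OF surj d] by (rule imageE)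
    have "ab_class G x = ab_class G y" using eq x y comb_D by simp
    then have "x \<in> derived G (carrier G) #>\<^bsub>G\<^esub> y"
      using rcos_self[OF x(2), of "derived G (carrier G)"] N
      by (simp add: ab_class_def normal_imp_subgroup)
    then obtain z where z: "z \<in> derived G (carrier G)" "x = z \<otimes>\<^bsub>G\<^esub> y" by (auto simp: r_coset_def)
    have zG: "z \<in> carrier G" using subgroup.mem_carrier[OF normal_imp_subgroup[OF N] z(1)] .
    have Dz: "D z = \<one>\<^bsub>?C\<^esub>"
      by (rule hom_into_comm_group_ker_derived[OF G C.comm_group_axioms D z(1)])
    have "D x = D z \<otimes>\<^bsub>?C\<^esub> D y" unfolding z(2) by (rule D.hom_mult[OF zG y(2)])
    also have "\<dots> = D y" unfolding Dz by (rule C.l_one[OF D.hom_closed[OF y(2)]])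
    finally show "c = d" unfolding x(1) y(1) .
  qed
  then show ?thesis
    unfolding ab_coords_def comb_D[OF g, symmetric]
    by (rule inv_into_f_f) (rule D.hom_closed[OF g])
qed


section \<open>Presented groups\<close>

lemma pres_class_letter:
  assumes x: "x \<in> X"
  shows "pres_cong X R `` {[(x, b)]} =
    (if b then pres_gen X R x else inv\<^bsub>pres_group X R\<^esub> (pres_gen X R x))"
proof (cases b)
  case True then show ?thesis by (simp add: pres_gen_def)
next
  case False
  interpret group "pres_group X R" by (rule group_pres_group)
  have "([(x, False), (x, True)], []) \<in> pres_cong X R"
    using pres_cong.cancel[OF x, of "[]" "[]" False R] by simp
  then have "pres_cong X R `` {[(x, False), (x, True)]} = pres_cong X R `` {[]}"
    by (rule equiv_class_eq[OF equiv_pres_cong])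
  then have "pres_cong X R `` {[(x, False)]} \<otimes>\<^bsub>pres_group X R\<^esub> pres_gen X R x = \<one>\<^bsub>pres_group X R\<^esub>"
    using x pres_mult_class[of "[(x, False)]" X "[(x, True)]" R]
    by (simp add: pres_gen_def one_pres_group)
  moreover have "pres_cong X R `` {[(x, False)]} \<in> carrier (pres_group X R)"
    unfolding carrier_pres_group using x by (intro bexI[of _ "[(x, False)]"]) auto
  ultimately show ?thesis using x False by (simp add: inv_equality pres_gen_closed)
qed

lemma gword_eval_pres_gen:
  assumes "w \<in> lists (X \<times> UNIV)"
  shows "gword_eval (pres_group X R) (pres_gen X R) w = pres_cong X R `` {w}"
  using assms
proof (induction w)
  case Nil then show ?case by (simp add: one_pres_group)
next
  case (Cons a w)
  obtain x b where a: "a = (x, b)" by force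
  have "pres_cong X R `` {a # w} = pres_cong X R `` {[a]} \<otimes>\<^bsub>pres_group X R\<^esub> pres_cong X R `` {w}"
    using pres_mult_class[of "[a]" X w R] Cons by simp
  then show ?case using Cons a pres_class_letter[of x X R b] by simp
qed

lemma gword_eval_pres_rel:
  assumes "(l, r) \<in> R" "l \<in> lists (X \<times> UNIV)" "r \<in> lists (X \<times> UNIV)"
  shows "gword_eval (pres_group X R) (pres_gen X R) l = gword_eval (pres_group X R) (pres_gen X R) r"
proof -
  have "(l, r) \<in> pres_cong X R" using pres_cong.rel[OF assms, of "[]" "[]"] by simp
  then have "pres_cong X R `` {l} = pres_cong X R `` {r}"
    by (rule equiv_class_eq[OF equiv_pres_cong])
  then show ?thesis using assms by (simp only: gword_eval_pres_gen)
qed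

lemma generate_pres_gen:
  "generate (pres_group X R) (pres_gen X R ` X) = carrier (pres_group X R)"
proof
  interpret group "pres_group X R" by (rule group_pres_group)
  let ?H = "generate (pres_group X R) (pres_gen X R ` X)"
  show "?H \<subseteq> carrier (pres_group X R)"
    by (rule generate_incl) (auto simp: pres_gen_closed)
  have "gword_eval (pres_group X R) (pres_gen X R) w \<in> ?H" if "w \<in> lists (X \<times> UNIV)" for w
    using that by (induction w) (auto intro!: generate.eng intro: generate.intros)
  then show "carrier (pres_group X R) \<subseteq> ?H"
    by (metis carrier_pres_group gword_eval_pres_gen subsetI)
qed

lemma gword_eval_power:
  assumes G: "group G" and "f \<in> X \<rightarrow> carrier G" "s \<in> X" "t \<in> X"
  shows "gword_eval G f (concat (replicate n [(s, True), (t, True)])) = (f s \<otimes>\<^bsub>G\<^esub> f t) [^]\<^bsub>G\<^esub> n"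
proof -
  interpret group G by (rule G)
  have c: "f s \<in> carrier G" "f t \<in> carrier G" using assms by auto
  show ?thesis
  proof (induction n)
    case (Suc n)
    have "f s \<otimes>\<^bsub>G\<^esub> (f t \<otimes>\<^bsub>G\<^esub> (f s \<otimes>\<^bsub>G\<^esub> f t) [^]\<^bsub>G\<^esub> n)
        = (f s \<otimes>\<^bsub>G\<^esub> f t) [^]\<^bsub>G\<^esub> Suc n"
      using c nat_pow_Suc2[of "f s \<otimes>\<^bsub>G\<^esub> f t" n] by (simp add: m_assoc)
    then show ?case using Suc by simp
  qed simp
qed


section \<open>Pullback squares\<close>

text \<open>
  A bijection with the set-theoretic fibre product suffices: the map that it
  induces from a test group is a homomorphism because elements of \<open>P\<close> are determined by their two
  images.
\<close>
lemma pullback_squareI: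
  assumes P: "group P" and A: "group A" and B: "group B" and C: "group C"
    and p: "p \<in> hom P A" and q: "q \<in> hom P B" and f: "f \<in> hom A C" and g: "g \<in> hom B C"
    and comm: "\<And>x. x \<in> carrier P \<Longrightarrow> f (p x) = g (q x)"
    and ex1: "\<And>a b. a \<in> carrier A \<Longrightarrow> b \<in> carrier B \<Longrightarrow> f a = g b \<Longrightarrow>
      \<exists>!x. x \<in> carrier P \<and> p x = a \<and> q x = b"
  shows "pullback_square TYPE('t) P A B C p q f g"
proof -
  have univ: "\<exists>!u. u \<in> hom T P \<and> u \<in> extensional (carrier T) \<and>
      (\<forall>t\<in>carrier T. p (u t) = h t \<and> q (u t) = k t)"
    if T: "group T" and h: "h \<in> hom T A" and k: "k \<in> hom T B"
      and hk: "\<forall>t\<in>carrier T. f (h t) = g (k t)" for T :: "'t monoid" and h k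
  proof -
    define u where "u = (\<lambda>t\<in>carrier T. THE x. x \<in> carrier P \<and> p x = h t \<and> q x = k t)"
    have ex1T: "\<exists>!x. x \<in> carrier P \<and> p x = h t \<and> q x = k t" if "t \<in> carrier T" for t
      using ex1[OF hom_in_carrier[OF h that] hom_in_carrier[OF k that]] hk that by blast
    have u: "u t \<in> carrier P \<and> p (u t) = h t \<and> q (u t) = k t" if "t \<in> carrier T" for t
      using theI'[OF ex1T[OF that]] that by (simp add: u_def)
    have "u \<in> hom T P"
    proof (rule homI)
      fix s t assume st: "s \<in> carrier T" "t \<in> carrier T"
      then have cl: "s \<otimes>\<^bsub>T\<^esub> t \<in> carrier T" "u s \<otimes>\<^bsub>P\<^esub> u t \<in> carrier P"
        using T P u by (auto simp: group_def monoid.m_closed)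
      have "p (u s \<otimes>\<^bsub>P\<^esub> u t) = h (s \<otimes>\<^bsub>T\<^esub> t)" "q (u s \<otimes>\<^bsub>P\<^esub> u t) = k (s \<otimes>\<^bsub>T\<^esub> t)"
        using u st by (simp_all add: hom_mult[OF p] hom_mult[OF q] hom_mult[OF h] hom_mult[OF k])
      then show "u (s \<otimes>\<^bsub>T\<^esub> t) = u s \<otimes>\<^bsub>P\<^esub> u t"
        using ex1T[OF cl(1)] u[OF cl(1)] cl(2) by blast
    qed (use u in blast)
    moreover have "v = u" if v: "v \<in> hom T P" "v \<in> extensional (carrier T)"
      "\<forall>t\<in>carrier T. p (v t) = h t \<and> q (v t) = k t" for v
    proof (rule extensionalityI[OF v(2)])
      show "u \<in> extensional (carrier T)" by (simp add: u_def)
    next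
      fix t assume t: "t \<in> carrier T"
      then show "v t = u t" using ex1T[OF t] u[OF t] v(3) hom_in_carrier[OF v(1) t] by blast
    qed
    moreover have "u \<in> extensional (carrier T)" by (simp add: u_def)
    ultimately show ?thesis using u by (intro ex1I[of _ u]) blast+
  qed
  show ?thesis unfolding pullback_square_def
    by (intro conjI allI impI ballI P A B C p q f g comm, assumption) (elim conjE, rule univ)
qed


section \<open>Coxeter groups and the adjoint groups of their quandles\<close>

locale coxeter_with_reps =
  fixes S R :: "'s set" and m :: "'s \<Rightarrow> 's \<Rightarrow> enat"
  assumes system: "coxeter_system S m" and reps: "complete_reps S m R"
begin

abbreviation "W \<equiv> coxeter_group S m"
abbreviation "A \<equiv> coxeter_adjoint S m"
abbreviation "X \<equiv> coxeter_quandle S m"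
abbreviation "\<sigma> \<equiv> coxeter_gen S m"
abbreviation "e \<equiv> coxeter_adjoint_gen S m"
abbreviation "\<phi> \<equiv> coxeter_phi S m"

sublocale W: group W by (rule group_coxeter_group)

sublocale A: group A
  unfolding coxeter_adjoint_def adjoint_group_def by (rule group_pres_group)

sublocale phi: group_hom A W \<phi>
  by unfold_locales (rule coxeter_phi(1))

lemma generate_sigma: "generate W (\<sigma> ` S) = carrier W"
  unfolding coxeter_group_def coxeter_gen_def[abs_def] by (rule generate_pres_gen)

lemma generate_e: "generate A (e ` X) = carrier A"
  unfolding coxeter_adjoint_def adjoint_group_def coxeter_adjoint_gen_def[abs_def]
    adjoint_gen_def[abs_def]
  by (rule generate_pres_gen)

lemma sigma_closed: "s \<in> S \<Longrightarrow> \<sigma> s \<in> carrier W"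
  by (rule coxeter_gen_closed)

lemma X_closed: "x \<in> X \<Longrightarrow> x \<in> carrier W"
  using coxeter_quandle_carrier by blast

lemma e_closed: "x \<in> X \<Longrightarrow> e x \<in> carrier A"
  unfolding coxeter_adjoint_def adjoint_group_def coxeter_adjoint_gen_def adjoint_gen_def
  by (rule pres_gen_closed)

lemma conj_sigma_X: "s \<in> S \<Longrightarrow> w \<in> carrier W \<Longrightarrow> conj_op W (\<sigma> s) w \<in> X"
  by (auto simp: coxeter_quandle_def)

lemma sigma_X: "s \<in> S \<Longrightarrow> \<sigma> s \<in> X"
  using conj_sigma_X[of s "\<one>\<^bsub>W\<^esub>"] sigma_closed by simp

lemma conj_X:
  assumes "x \<in> X" "w \<in> carrier W" shows "conj_op W x w \<in> X"
proof -
  obtain v s where "x = conj_op W (\<sigma> s) v" "v \<in> carrier W" "s \<in> S"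
    using assms(1) by (auto simp: coxeter_quandle_def)
  then show ?thesis using assms(2) by (simp add: W.conj_op_mult sigma_closed conj_sigma_X)
qed

lemma W_lift:
  assumes H: "group H" and f: "f \<in> S \<rightarrow> carrier H"
    and rel: "\<And>s t n. s \<in> S \<Longrightarrow> t \<in> S \<Longrightarrow> m s t = enat n \<Longrightarrow> (f s \<otimes>\<^bsub>H\<^esub> f t) [^]\<^bsub>H\<^esub> n = \<one>\<^bsub>H\<^esub>"
  obtains h where "h \<in> hom W H" "\<And>s. s \<in> S \<Longrightarrow> h (\<sigma> s) = f s"
proof
  have R: "gword_eval H f l = gword_eval H f r" if "(l, r) \<in> coxeter_rels S m" for l r
    using that rel gword_eval_power[OF H f] by (auto simp: coxeter_rels_def)
  show "pres_lift H f \<in> hom W H"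
    unfolding coxeter_group_def by (rule pres_lift_hom[OF H f R])
  show "pres_lift H f (\<sigma> s) = f s" if "s \<in> S" for s
    unfolding coxeter_gen_def by (rule pres_lift_gen[OF H f R that])
qed

lemma A_lift:
  assumes H: "group H" and f: "f \<in> X \<rightarrow> carrier H"
    and rel: "\<And>x y. x \<in> X \<Longrightarrow> y \<in> X \<Longrightarrow> f (conj_op W x y) = conj_op H (f x) (f y)"
  obtains h where "h \<in> hom A H" "\<And>x. x \<in> X \<Longrightarrow> h (e x) = f x"
proof
  interpret H: group H by (rule H)
  have R: "gword_eval H f l = gword_eval H f r" if "(l, r) \<in> adjoint_rels X (conj_op W)" for l r
    using that rel f by (auto simp: adjoint_rels_def conj_op_def H.m_assoc Pi_iff)
  show "pres_lift H f \<in> hom A H"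
    unfolding coxeter_adjoint_def adjoint_group_def by (rule pres_lift_hom[OF H f R])
  show "pres_lift H f (e x) = f x" if "x \<in> X" for x
    unfolding coxeter_adjoint_gen_def adjoint_gen_def by (rule pres_lift_gen[OF H f R that])
qed

lemma sigma_rel:
  assumes st: "s \<in> S" "t \<in> S" and n: "m s t = enat n"
  shows "(\<sigma> s \<otimes>\<^bsub>W\<^esub> \<sigma> t) [^]\<^bsub>W\<^esub> n = \<one>\<^bsub>W\<^esub>"
proof -
  let ?l = "concat (replicate n [(s, True), (t, True)])"
  have "(?l, []) \<in> coxeter_rels S m" using assms by (auto simp: coxeter_rels_def)
  moreover have "?l \<in> lists (S \<times> UNIV)" using st by (induction n) auto
  ultimately have "gword_eval W \<sigma> ?l = gword_eval W \<sigma> []"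
    unfolding coxeter_group_def coxeter_gen_def[abs_def] by (intro gword_eval_pres_rel) auto
  then show ?thesis
    using gword_eval_power[OF W.is_group, of \<sigma> S s t n] sigma_closed st by simp
qed

lemma e_rel:
  assumes xy: "x \<in> X" "y \<in> X" shows "e (conj_op W x y) = conj_op A (e x) (e y)"
proof -
  let ?R = "adjoint_rels X (conj_op W)" and ?z = "conj_op W x y"
  have z: "?z \<in> X" using xy by (simp add: conj_X X_closed)
  have "([(?z, True)], [(y, False), (x, True), (y, True)]) \<in> ?R"
    using xy by (auto simp: adjoint_rels_def)
  then have "gword_eval A e [(?z, True)] = gword_eval A e [(y, False), (x, True), (y, True)]"
    unfolding coxeter_adjoint_def adjoint_group_def coxeter_adjoint_gen_def[abs_def]
      adjoint_gen_def[abs_def]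
    using xy z by (intro gword_eval_pres_rel) auto
  then show ?thesis using xy z by (simp add: conj_op_def e_closed A.m_assoc)
qed

lemma sigma_involution: assumes "s \<in> S" shows "\<sigma> s \<otimes>\<^bsub>W\<^esub> \<sigma> s = \<one>\<^bsub>W\<^esub>"
proof -
  have "m s s = enat 1" using system assms by (auto simp: coxeter_system_def one_enat_def)
  then show ?thesis using sigma_rel[OF assms assms] sigma_closed[OF assms] by simp
qed

lemma phi_e: "x \<in> X \<Longrightarrow> \<phi> (e x) = x"
  by (rule coxeter_phi(2))

lemma phi_surj: "\<phi> ` carrier A = carrier W"
proof
  have "\<sigma> ` S \<subseteq> \<phi> ` carrier A"
  proof (rule image_subsetI)
    fix s assume "s \<in> S"
    then have "\<sigma> s \<in> X" by (rule sigma_X)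
    then show "\<sigma> s \<in> \<phi> ` carrier A" 
      by (intro image_eqI[where x = "e (\<sigma> s)"]) (simp_all only: phi_e e_closed)
  qed
  then have "generate W (\<sigma> ` S) \<subseteq> \<phi> ` carrier A"
    by (rule generate_subset_hom_image[OF A.is_group W.is_group coxeter_phi(1) A.subgroup_self])
  then show "carrier W \<subseteq> \<phi> ` carrier A" by (simp only: generate_sigma)
qed auto

text \<open>
  The defining relations of \<open>A\<close> say this for \<open>g = e y\<close>, and both sides are actions of \<open>A\<close>.
\<close>
lemma conj_e:
  assumes x: "x \<in> X" and g: "g \<in> carrier A"
  shows "conj_op A (e x) g = e (conj_op W x (\<phi> g))"
proof -
  have T: "e ` X \<subseteq> carrier A" using e_closed by blast
  have "g \<in> generate A (e ` X)" using g by (simp only: generate_e)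
  then show ?thesis using x
  proof (induction arbitrary: x rule: generate.induct)
    case one then show ?case by (simp add: e_closed X_closed)
  next
    case (incl h) then show ?case by (auto simp: e_rel phi_e)
  next
    case (inv h)
    then obtain y where y: "y \<in> X" "h = e y" by blast
    let ?x = "conj_op W x (inv\<^bsub>W\<^esub> y)"
    have x': "?x \<in> X" using inv y by (simp add: conj_X X_closed)
    have "conj_op A (e ?x) (e y) = e x"
      using e_rel[OF x' y(1)] inv y by (simp add: X_closed)
    then have "conj_op A (e x) (inv\<^bsub>A\<^esub> e y) = e ?x"
      using A.conj_op_cancel(1)[OF e_closed[OF x'] e_closed[OF y(1)]] by simp
    then show ?case using y by (simp add: e_closed phi_e)
  next
    case (eng h1 h2)
    then have h: "h1 \<in> carrier A" "h2 \<in> carrier A" using A.generate_in_carrier[OF T] by auto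
    have "conj_op A (e x) (h1 \<otimes>\<^bsub>A\<^esub> h2) = conj_op A (conj_op A (e x) h1) h2"
      using h eng.prems by (simp add: A.conj_op_mult e_closed)
    also have "\<dots> = e (conj_op W (conj_op W x (\<phi> h1)) (\<phi> h2))"
      using h eng by (simp add: conj_X)
    also have "\<dots> = e (conj_op W x (\<phi> (h1 \<otimes>\<^bsub>A\<^esub> h2)))"
      using h eng.prems by (simp add: W.conj_op_mult X_closed)
    finally show ?case .
  qed
qed

lemma ker_phi_central:
  assumes z: "z \<in> carrier A" "\<phi> z = \<one>\<^bsub>W\<^esub>" and g: "g \<in> carrier A"
  shows "g \<otimes>\<^bsub>A\<^esub> z = z \<otimes>\<^bsub>A\<^esub> g"
proof -
  have "conj_op A g z = g"
  proof (rule hom_eq_on_generate[OF A.is_group A.is_group A.conj_op_hom[OF z(1)]])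
    show "(\<lambda>g. g) \<in> hom A A" by (simp add: hom_def)
    show "e ` X \<subseteq> carrier A" using e_closed by blast
    show "g \<in> generate A (e ` X)" using g by (simp only: generate_e)
    show "conj_op A t z = t" if "t \<in> e ` X" for t
      using that z by (auto simp: conj_e X_closed)
  qed
  then show ?thesis using A.conj_op_fixed_iff[OF g z(1)] by simp
qed

lemma e_conj_sigma:
  assumes s: "s \<in> S" and w: "w \<in> carrier W"
  shows "\<exists>g\<in>carrier A. e (conj_op W (\<sigma> s) w) = conj_op A (e (\<sigma> s)) g"
proof -
  obtain g where "g \<in> carrier A" "w = \<phi> g" using phi_surj w by blast
  then show ?thesis using conj_e[OF sigma_X[OF s]] by auto
qed

text \<open>
  The subgroup generated by the \<open>e (\<sigma> s)\<close> already maps onto \<open>W\<close>, so conjugating within this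
  subgroup reaches \<open>e x\<close> for every reflection \<open>x\<close>, by \<open>conj_e\<close>. Identities between homomorphisms
  on \<open>A\<close> can thus be checked on the generators of \<open>W\<close>.
\<close>
lemma generate_e_sigma: "generate A ((\<lambda>s. e (\<sigma> s)) ` S) = carrier A"
proof
  let ?T = "(\<lambda>s. e (\<sigma> s)) ` S" and ?H = "generate A ((\<lambda>s. e (\<sigma> s)) ` S)"
  have T: "?T \<subseteq> carrier A" by (auto simp: e_closed sigma_X)
  then show "?H \<subseteq> carrier A" by (rule A.generate_incl)
  have sub: "subgroup ?H A" by (rule A.generate_is_subgroup[OF T])
  have eH: "e (\<sigma> s) \<in> ?H" if "s \<in> S" for s using that by (intro generate.incl) auto
  have "\<sigma> ` S \<subseteq> \<phi> ` ?H"
  proof (rule image_subsetI)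
    fix s assume s: "s \<in> S"
    show "\<sigma> s \<in> \<phi> ` ?H" 
      by (rule image_eqI[where x = "e (\<sigma> s)"]) (simp_all only: phi_e sigma_X s eH)
  qed
  then have "generate W (\<sigma> ` S) \<subseteq> \<phi> ` ?H"
    by (rule generate_subset_hom_image[OF A.is_group W.is_group coxeter_phi(1) sub])
  then have surj: "carrier W \<subseteq> \<phi> ` ?H" by (simp only: generate_sigma)
  have "e ` X \<subseteq> ?H"
  proof (rule image_subsetI)
    fix x assume "x \<in> X"
    then obtain w s where x: "x = conj_op W (\<sigma> s) w" "w \<in> carrier W" "s \<in> S"
      by (auto simp: coxeter_quandle_def)
    obtain g where g: "g \<in> ?H" "w = \<phi> g" using surj x(2) by blast
    then have "g \<in> carrier A" using subgroup.mem_carrier[OF sub] by blast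
    then have "e x = conj_op A (e (\<sigma> s)) g" using x g by (simp add: conj_e sigma_X)
    then show "e x \<in> ?H"
      using eH[OF x(3)] g(1) by (simp add: conj_op_def subgroup.m_closed[OF sub] subgroup.m_inv_closed[OF sub])
  qed
  then show "carrier A \<subseteq> ?H"
    using A.generate_subgroup_incl[OF _ sub, of "e ` X"] by (simp only: generate_e)
qed

definition class_rep :: "'s gword set \<Rightarrow> 's" where
  "class_rep x = (SOME r. r \<in> R \<and> (\<exists>w\<in>carrier W. x = conj_op W (\<sigma> r) w))"

lemma R_S: "r \<in> R \<Longrightarrow> r \<in> S"
  using reps by (auto simp: complete_reps_def)

lemma class_rep:
  assumes "x \<in> X"
  shows "class_rep x \<in> R" "\<exists>w\<in>carrier W. x = conj_op W (\<sigma> (class_rep x)) w"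
proof -
  obtain w s where x: "x = conj_op W (\<sigma> s) w" "w \<in> carrier W" "s \<in> S"
    using assms by (auto simp: coxeter_quandle_def)
  obtain r v where r: "r \<in> R" "v \<in> carrier W" "conj_op W (\<sigma> s) v = \<sigma> r"
    using reps x(3) unfolding complete_reps_def coxeter_conjugate_def by blast
  have "conj_op W (\<sigma> r) (inv\<^bsub>W\<^esub> v \<otimes>\<^bsub>W\<^esub> w) = conj_op W (conj_op W (\<sigma> r) (inv\<^bsub>W\<^esub> v)) w"
    using r x R_S by (simp add: W.conj_op_mult sigma_closed)
  also have "\<dots> = x" using r(2) x sigma_closed by (simp flip: r(3))
  finally have "\<exists>r. r \<in> R \<and> (\<exists>w\<in>carrier W. x = conj_op W (\<sigma> r) w)"
    using r x by (metis W.inv_closed W.m_closed)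
  then have "class_rep x \<in> R \<and> (\<exists>w\<in>carrier W. x = conj_op W (\<sigma> (class_rep x)) w)"
    unfolding class_rep_def by (rule someI_ex)
  then show "class_rep x \<in> R" "\<exists>w\<in>carrier W. x = conj_op W (\<sigma> (class_rep x)) w" by simp_all
qed

lemma class_rep_eq:
  assumes r: "r \<in> R" and w: "w \<in> carrier W"
  shows "class_rep (conj_op W (\<sigma> r) w) = r"
proof -
  let ?x = "conj_op W (\<sigma> r) w"
  have x: "?x \<in> X" by (rule conj_sigma_X[OF R_S[OF r] w])
  obtain v where v: "v \<in> carrier W" "?x = conj_op W (\<sigma> (class_rep ?x)) v"
    using class_rep(2)[OF x] by blast
  have "conj_op W (\<sigma> r) (w \<otimes>\<^bsub>W\<^esub> inv\<^bsub>W\<^esub> v) = conj_op W ?x (inv\<^bsub>W\<^esub> v)"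
    using r w v(1) R_S by (simp add: W.conj_op_mult sigma_closed)
  also have "\<dots> = \<sigma> (class_rep ?x)"
    by (subst v(2)) (use v(1) class_rep(1)[OF x] R_S sigma_closed in simp)
  finally have "coxeter_conjugate S m r (class_rep ?x)"
    unfolding coxeter_conjugate_def using w v(1) by blast
  moreover have "coxeter_conjugate S m r r"
    unfolding coxeter_conjugate_def using r R_S sigma_closed by (intro bexI[of _ "\<one>\<^bsub>W\<^esub>"]) simp_all
  ultimately show ?thesis
    using reps r class_rep(1)[OF x] R_S unfolding complete_reps_def by blast
qed

lemma class_rep_sigma: "r \<in> R \<Longrightarrow> class_rep (\<sigma> r) = r"
  using class_rep_eq[of r "\<one>\<^bsub>W\<^esub>"] R_S sigma_closed by simp

lemma class_rep_conj:
  assumes x: "x \<in> X" and w: "w \<in> carrier W"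
  shows "class_rep (conj_op W x w) = class_rep x"
proof -
  obtain v where v: "v \<in> carrier W" "x = conj_op W (\<sigma> (class_rep x)) v"
    using class_rep(2)[OF x] by blast
  have "conj_op W x w = conj_op W (\<sigma> (class_rep x)) (v \<otimes>\<^bsub>W\<^esub> w)"
    by (subst v(2)) (use v(1) w class_rep(1)[OF x] R_S sigma_closed in \<open>simp add: W.conj_op_mult\<close>)
  then show ?thesis using class_rep_eq[OF class_rep(1)[OF x]] v(1) w by simp
qed

lemma sigma_conj_pow:
  assumes st: "s \<in> S" "t \<in> S" and n: "m s t = enat n"
  shows "conj_op W (\<sigma> s) ((\<sigma> s \<otimes>\<^bsub>W\<^esub> \<sigma> t) [^]\<^bsub>W\<^esub> (Suc n div 2)) = (if even n then \<sigma> s else \<sigma> t)"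
  using W.involutions_pow_eq_one_iff[of "\<sigma> s" "\<sigma> t" n] sigma_rel[OF st n]
    sigma_involution sigma_closed st by simp

lemma class_rep_odd:
  assumes st: "s \<in> S" "t \<in> S" and n: "m s t = enat n" "odd n"
  shows "class_rep (\<sigma> s) = class_rep (\<sigma> t)"
proof -
  have "class_rep (conj_op W (\<sigma> s) ((\<sigma> s \<otimes>\<^bsub>W\<^esub> \<sigma> t) [^]\<^bsub>W\<^esub> (Suc n div 2))) = class_rep (\<sigma> s)"
    by (rule class_rep_conj) (use st sigma_X sigma_closed in auto)
  then show ?thesis using sigma_conj_pow[OF st n(1)] n(2) by simp
qed

text \<open>
  The class of a reflection is invariant under conjugation, and conjugation in the abelian
  target is trivial, so the relations of \<open>A\<close> are respected.
\<close>
lemma A_degree: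
  obtains D where "D \<in> hom A (cyclic_sum 0 R)"
    "\<And>x. x \<in> X \<Longrightarrow> D (e x) = basis_vec 0 R (class_rep x)"
proof -
  interpret C: comm_group "cyclic_sum 0 R" by (rule comm_group_cyclic_sum)
  show ?thesis
  proof (rule A_lift[OF C.is_group, of "\<lambda>x. basis_vec 0 R (class_rep x)"])
    show "(\<lambda>x. basis_vec 0 R (class_rep x)) \<in> X \<rightarrow> carrier (cyclic_sum 0 R)"
      by (intro funcsetI basis_vec_closed)
    show "basis_vec 0 R (class_rep (conj_op W x y)) =
        conj_op (cyclic_sum 0 R) (basis_vec 0 R (class_rep x)) (basis_vec 0 R (class_rep y))"
      if "x \<in> X" "y \<in> X" for x y
      using that by (simp add: class_rep_conj X_closed C.conj_op_trivial[OF basis_vec_closed basis_vec_closed])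
  qed (rule that)
qed

text \<open>
  In an abelian group the criterion \<open>involutions_pow_eq_one_iff\<close> only asks that \<open>a = b\<close> when
  \<open>n\<close> is odd, which is \<open>class_rep_odd\<close>.
\<close>
lemma W_degree:
  obtains D where "D \<in> hom W (cyclic_sum 2 R)"
    "\<And>s. s \<in> S \<Longrightarrow> D (\<sigma> s) = basis_vec 2 R (class_rep (\<sigma> s))"
proof -
  let ?C = "cyclic_sum 2 R" and ?b = "\<lambda>s. basis_vec 2 R (class_rep (\<sigma> s))"
  interpret C: comm_group ?C by (rule comm_group_cyclic_sum)
  have inv: "?b s \<otimes>\<^bsub>?C\<^esub> ?b s = \<one>\<^bsub>?C\<^esub>" for s
    by (auto simp: basis_vec_def fun_eq_iff)
  show ?thesis
  proof (rule W_lift[OF C.is_group, of ?b])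
    show "?b \<in> S \<rightarrow> carrier ?C" by (intro funcsetI basis_vec_closed)
  next
    fix s t n assume st: "s \<in> S" "t \<in> S" and n: "m s t = enat n"
    have "conj_op ?C (?b s) ((?b s \<otimes>\<^bsub>?C\<^esub> ?b t) [^]\<^bsub>?C\<^esub> (Suc n div 2)) = ?b s"
      by (intro C.conj_op_trivial C.nat_pow_closed C.m_closed basis_vec_closed)
    also have "\<dots> = (if even n then ?b s else ?b t)" using class_rep_odd[OF st n] by auto
    finally show "(?b s \<otimes>\<^bsub>?C\<^esub> ?b t) [^]\<^bsub>?C\<^esub> n = \<one>\<^bsub>?C\<^esub>"
      by (simp only: C.involutions_pow_eq_one_iff[OF basis_vec_closed inv basis_vec_closed inv])
  qed (rule that)
qed

text \<open>
  The lift is taken into the kernel of \<open>\<phi>\<close>, which is an abelian group by \<open>ker_phi_central\<close> and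
  contains \<open>(e (\<sigma> r))\<^sup>2\<close> because \<open>\<sigma> r\<close> is an involution.
\<close>
lemma ker_phi_squares:
  obtains E where "E \<in> hom (cyclic_sum 0 R) A"
    "\<And>c. c \<in> carrier (cyclic_sum 0 R) \<Longrightarrow> \<phi> (E c) = \<one>\<^bsub>W\<^esub>"
    "\<And>r. r \<in> R \<Longrightarrow> E (basis_vec 0 R r) = e (\<sigma> r) \<otimes>\<^bsub>A\<^esub> e (\<sigma> r)"
proof -
  let ?K = "kernel A W \<phi>"
  have K: "subgroup ?K A" by (rule phi.subgroup_kernel)
  have comm: "x \<otimes>\<^bsub>A\<^esub> y = y \<otimes>\<^bsub>A\<^esub> x" if "x \<in> ?K" "y \<in> ?K" for x y
    using that by (intro ker_phi_central) (simp_all add: kernel_def)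
  interpret K: comm_group "A\<lparr>carrier := ?K\<rparr>"
    by (rule group.group_comm_groupI[OF A.subgroup_imp_group[OF K]]) (use comm in simp)
  let ?f = "\<lambda>r. e (\<sigma> r) \<otimes>\<^bsub>A\<^esub> e (\<sigma> r)"
  have f: "?f \<in> R \<rightarrow> carrier (A\<lparr>carrier := ?K\<rparr>)"
    by (auto simp: kernel_def e_closed sigma_X R_S phi_e sigma_involution)
  obtain E where E: "E \<in> hom (cyclic_sum 0 R) (A\<lparr>carrier := ?K\<rparr>)"
    and Eb: "\<And>r. r \<in> R \<Longrightarrow> E (basis_vec 0 R r) = ?f r"
    using K.cyclic_sum_lift[OF f, of 0] by auto
  show ?thesis
  proof (rule that[OF _ _ Eb])
    show "E \<in> hom (cyclic_sum 0 R) A" using E by (auto simp: hom_def kernel_def Pi_iff)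
    show "\<phi> (E c) = \<one>\<^bsub>W\<^esub>" if "c \<in> carrier (cyclic_sum 0 R)" for c
      using hom_in_carrier[OF E that] by (simp add: kernel_def)
  qed
qed

lemma e_sigma_conj_rep:
  assumes s: "s \<in> S"
  shows "\<exists>r\<in>R. \<exists>g\<in>carrier A. e (\<sigma> s) = conj_op A (e (\<sigma> r)) g"
proof -
  define r where "r = class_rep (\<sigma> s)"
  have r: "r \<in> R" using class_rep(1)[OF sigma_X[OF s]] by (simp add: r_def)
  obtain w where w: "w \<in> carrier W" "\<sigma> s = conj_op W (\<sigma> r) w"
    using class_rep(2)[OF sigma_X[OF s]] by (auto simp: r_def)
  show ?thesis
    using e_conj_sigma[OF R_S[OF r] w(1)] r w(2) by (intro bexI[of _ r]) simp_all
qed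
text \<open>
  With \<open>N\<close> the group of products of the squares, the assignment \<open>\<sigma> s \<mapsto> N e(\<sigma> s)\<close> extends to a
  homomorphism \<open>\<psi>: W \<rightarrow> A/N\<close>, and \<open>\<psi> \<circ> \<phi>\<close> is the quotient map. So the kernel of \<open>\<phi>\<close> is
  contained in \<open>N\<close>.
\<close>
lemma ker_phi_subset_squares:
  assumes E: "E \<in> hom (cyclic_sum 0 R) A"
    and E1: "\<And>c. c \<in> carrier (cyclic_sum 0 R) \<Longrightarrow> \<phi> (E c) = \<one>\<^bsub>W\<^esub>"
    and Eb: "\<And>r. r \<in> R \<Longrightarrow> E (basis_vec 0 R r) = e (\<sigma> r) \<otimes>\<^bsub>A\<^esub> e (\<sigma> r)"
    and z: "z \<in> carrier A" "\<phi> z = \<one>\<^bsub>W\<^esub>"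
  shows "z \<in> E ` carrier (cyclic_sum 0 R)"
proof -
  let ?C = "cyclic_sum 0 R"
  interpret E: group_hom ?C A E
    using E by (simp add: group_hom_def group_hom_axioms_def A.is_group)
  define N where "N = E ` carrier ?C"
  have N1: "h \<in> carrier A" "\<phi> h = \<one>\<^bsub>W\<^esub>" if "h \<in> N" for h
    using that E1 by (auto simp: N_def simp del: mult_sum_group)
  have subN: "subgroup N A" unfolding N_def by (rule E.img_is_subgroup)
  have "N \<lhd> A"
    unfolding A.normal_inv_iff
  proof (intro conjI subN ballI)
    fix g h assume "g \<in> carrier A" "h \<in> N"
    then show "g \<otimes>\<^bsub>A\<^esub> h \<otimes>\<^bsub>A\<^esub> inv\<^bsub>A\<^esub> g \<in> N"
      using ker_phi_central[of h g] N1[of h] by (simp add: A.m_assoc)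
  qed
  then interpret N: normal N A .
  let ?Q = "A Mod N" and ?\<pi> = "\<lambda>g. N #>\<^bsub>A\<^esub> g"
  interpret Q: group ?Q by (rule N.factorgroup_is_group)
  have pi: "?\<pi> \<in> hom A ?Q" by (rule N.r_coset_hom_Mod)
  interpret pi: group_hom A ?Q ?\<pi> by unfold_locales (rule pi)
  define f where "f = (\<lambda>s. ?\<pi> (e (\<sigma> s)))"
  have eA: "e (\<sigma> s) \<in> carrier A" if "s \<in> S" for s using that by (simp add: e_closed sigma_X)
  have fQ: "f s \<in> carrier ?Q" if "s \<in> S" for s
    unfolding f_def by (rule pi.hom_closed[OF eA[OF that]])
  \<comment> \<open>A central element is invariant under conjugation, so \<open>e (\<sigma> s)\<close> and the conjugate
    \<open>e (\<sigma> r)\<close> with \<open>r \<in> R\<close> have the same square.\<close>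
  have f2: "f s \<otimes>\<^bsub>?Q\<^esub> f s = \<one>\<^bsub>?Q\<^esub>" if s: "s \<in> S" for s
  proof -
    obtain r g where r: "r \<in> R" and g: "g \<in> carrier A" "e (\<sigma> s) = conj_op A (e (\<sigma> r)) g"
      using e_sigma_conj_rep[OF s] by blast
    have sq: "e (\<sigma> r) \<otimes>\<^bsub>A\<^esub> e (\<sigma> r) \<in> N"
      unfolding N_def Eb[OF r, symmetric] by (rule imageI[OF basis_vec_closed])
    have "e (\<sigma> s) \<otimes>\<^bsub>A\<^esub> e (\<sigma> s) = conj_op A (e (\<sigma> r) \<otimes>\<^bsub>A\<^esub> e (\<sigma> r)) g"
      unfolding g(2) using hom_mult[OF A.conj_op_hom[OF g(1)] eA eA] R_S[OF r] by simp
    also have "\<dots> = e (\<sigma> r) \<otimes>\<^bsub>A\<^esub> e (\<sigma> r)"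
      using A.conj_op_fixed_iff[OF N1(1)[OF sq] g(1)] ker_phi_central[OF N1[OF sq] g(1)] by simp
    finally have "e (\<sigma> s) \<otimes>\<^bsub>A\<^esub> e (\<sigma> s) \<in> N" using sq by simp
    then have "?\<pi> (e (\<sigma> s) \<otimes>\<^bsub>A\<^esub> e (\<sigma> s)) = \<one>\<^bsub>?Q\<^esub>"
      by (simp add: N.rcos_const)
    then show ?thesis unfolding f_def using pi.hom_mult[OF eA[OF s] eA[OF s]] by simp
  qed
  obtain \<psi> where psi: "\<psi> \<in> hom W ?Q" and psi_sigma: "\<And>s. s \<in> S \<Longrightarrow> \<psi> (\<sigma> s) = f s"
  proof (rule W_lift[OF Q.is_group, of f])
    show "f \<in> S \<rightarrow> carrier ?Q" using fQ by blast
    fix s t n assume st: "s \<in> S" "t \<in> S" and n: "m s t = enat n"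
    let ?g = "(e (\<sigma> s) \<otimes>\<^bsub>A\<^esub> e (\<sigma> t)) [^]\<^bsub>A\<^esub> (Suc n div 2)"
    have g: "?g \<in> carrier A" using eA st by simp
    \<comment> \<open>The Coxeter relation in \<open>W\<close>, read as a conjugation, lifts to \<open>A\<close> and descends to \<open>A/N\<close>.\<close>
    have "\<phi> ?g = (\<sigma> s \<otimes>\<^bsub>W\<^esub> \<sigma> t) [^]\<^bsub>W\<^esub> (Suc n div 2)"
      using eA st by (simp add: phi.hom_nat_pow phi_e sigma_X)
    then have "conj_op A (e (\<sigma> s)) ?g = e (if even n then \<sigma> s else \<sigma> t)"
      using conj_e[OF sigma_X[OF st(1)] g] sigma_conj_pow[OF st n] by simp
    then have "?\<pi> (conj_op A (e (\<sigma> s)) ?g) = (if even n then f s else f t)"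
      by (simp add: f_def)
    moreover have "?\<pi> (conj_op A (e (\<sigma> s)) ?g) = conj_op ?Q (f s) (?\<pi> ?g)"
      unfolding f_def by (rule pi.hom_conj_op[OF eA[OF st(1)] g])
    moreover have "?\<pi> ?g = (f s \<otimes>\<^bsub>?Q\<^esub> f t) [^]\<^bsub>?Q\<^esub> (Suc n div 2)"
      unfolding f_def pi.hom_mult[OF eA[OF st(1)] eA[OF st(2)], symmetric]
      by (rule pi.hom_nat_pow) (simp add: eA st)
    ultimately show "(f s \<otimes>\<^bsub>?Q\<^esub> f t) [^]\<^bsub>?Q\<^esub> n = \<one>\<^bsub>?Q\<^esub>"
      using Q.involutions_pow_eq_one_iff[OF fQ f2 fQ f2, OF st(1) st(1) st(2) st(2)] by simp
  qed blast
  interpret psi: group_hom W ?Q \<psi> by unfold_locales (rule psi)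
  have "(\<psi> \<circ> \<phi>) z = ?\<pi> z"
  proof (rule hom_eq_on_generate[OF A.is_group Q.is_group _ pi])
    show "\<psi> \<circ> \<phi> \<in> hom A ?Q" by (rule Group.hom_compose[OF coxeter_phi(1) psi])
    show "(\<lambda>s. e (\<sigma> s)) ` S \<subseteq> carrier A" using eA by blast
    show "z \<in> generate A ((\<lambda>s. e (\<sigma> s)) ` S)" using z(1) by (simp only: generate_e_sigma)
    show "(\<psi> \<circ> \<phi>) t = ?\<pi> t" if "t \<in> (\<lambda>s. e (\<sigma> s)) ` S" for t
      using that psi_sigma by (auto simp: phi_e sigma_X f_def)
  qed
  then have "N #>\<^bsub>A\<^esub> z = N" using z(2) psi.hom_one by simp
  then show ?thesis using A.rcos_self[OF z(1) subN] by (simp add: N_def)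
qed

text \<open>
  Existence: correct any preimage \<open>g\<close> of \<open>w\<close> by the product of squares with exponents
  \<open>(c - DA g)/2\<close>. Uniqueness: two solutions differ by a product of squares whose exponents
  doubled vanish.
\<close>
lemma square_bijective:
  assumes DA: "DA \<in> hom A (cyclic_sum 0 R)" "\<And>x. x \<in> X \<Longrightarrow> DA (e x) = basis_vec 0 R (class_rep x)"
    and comm: "\<And>g. g \<in> carrier A \<Longrightarrow> reduce_mod2 R (DA g) = DW (\<phi> g)"
    and c: "c \<in> carrier (cyclic_sum 0 R)" and w: "w \<in> carrier W" and cw: "reduce_mod2 R c = DW w"
  shows "\<exists>!g. g \<in> carrier A \<and> DA g = c \<and> \<phi> g = w"
proof -
  let ?C = "cyclic_sum 0 R"
  interpret C: comm_group ?C by (rule comm_group_cyclic_sum)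
  interpret DA: group_hom A ?C DA by unfold_locales (rule DA(1))
  obtain E where E: "E \<in> hom ?C A"
    and E1: "\<And>c. c \<in> carrier ?C \<Longrightarrow> \<phi> (E c) = \<one>\<^bsub>W\<^esub>"
    and Eb: "\<And>r. r \<in> R \<Longrightarrow> E (basis_vec 0 R r) = e (\<sigma> r) \<otimes>\<^bsub>A\<^esub> e (\<sigma> r)"
    using ker_phi_squares by blast
  interpret E: group_hom ?C A E by unfold_locales (rule E)
  have DE: "DA (E d) = d \<otimes>\<^bsub>?C\<^esub> d" if d: "d \<in> carrier ?C" for d
  proof -
    have "(DA \<circ> E) d = d \<otimes>\<^bsub>?C\<^esub> d"
    proof (rule hom_eq_on_generate[OF C.is_group C.is_group Group.hom_compose[OF E DA(1)]])
      show "(\<lambda>d. d \<otimes>\<^bsub>?C\<^esub> d) \<in> hom ?C ?C"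
        by (rule homI) (simp_all only: C.m_closed C.m_ac)
      show "basis_vec 0 R ` R \<subseteq> carrier ?C" by (intro image_subsetI basis_vec_closed)
      show "d \<in> generate ?C (basis_vec 0 R ` R)" using d by (simp only: generate_basis_vec)
      fix b assume "b \<in> basis_vec 0 R ` R"
      then obtain r where r: "r \<in> R" "b = basis_vec 0 R r" by blast
      have "e (\<sigma> r) \<in> carrier A" "DA (e (\<sigma> r)) = b"
        using r R_S sigma_X e_closed DA(2) class_rep_sigma by simp_all
      then have "DA (e (\<sigma> r) \<otimes>\<^bsub>A\<^esub> e (\<sigma> r)) = b \<otimes>\<^bsub>?C\<^esub> b" by (simp only: DA.hom_mult)
      then show "(DA \<circ> E) b = b \<otimes>\<^bsub>?C\<^esub> b" using Eb[OF r(1)] r(2) by simp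
    qed
    then show ?thesis by simp
  qed
  show ?thesis
  proof (rule ex_ex1I)
    have "w \<in> \<phi> ` carrier A" using w by (simp only: phi_surj)
    then obtain g where g: "g \<in> carrier A" "\<phi> g = w" by (elim imageE) simp
    have Dg: "DA g \<in> carrier ?C" by (rule DA.hom_closed[OF g(1)])
    define d where "d = (\<lambda>r\<in>R. (c r - DA g r) div 2)"
    have "d r = 0" if "r \<in> R" "c r = 0" "DA g r = 0" for r using that by (simp add: d_def)
    then have "{r \<in> R. d r \<noteq> 0} \<subseteq> {r \<in> R. c r \<noteq> 0} \<union> {r \<in> R. DA g r \<noteq> 0}" by blast
    moreover have "finite ({r \<in> R. c r \<noteq> 0} \<union> {r \<in> R. DA g r \<noteq> 0})"
      using c Dg unfolding carrier_cyclic_sum by simp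
    ultimately have "finite {r \<in> R. d r \<noteq> 0}" by (rule finite_subset)
    then have d: "d \<in> carrier ?C" by (simp add: carrier_cyclic_sum d_def)
    have "c r mod 2 = DA g r mod 2" if "r \<in> R" for r
      using comm[OF g(1)] cw g(2) that unfolding reduce_mod2_def by (metis restrict_apply')
    then have "even (c r - DA g r)" if "r \<in> R" for r
      using that by (simp add: mod_eq_dvd_iff)
    then have "DA g r + (d r + d r) = c r" if "r \<in> R" for r
      using that by (simp add: d_def flip: mult_2)
    then have "DA g \<otimes>\<^bsub>?C\<^esub> (d \<otimes>\<^bsub>?C\<^esub> d) = c"
      using c by (auto simp: carrier_cyclic_sum extensional_def fun_eq_iff)
    then have "DA (g \<otimes>\<^bsub>A\<^esub> E d) = c"
      using DA.hom_mult[OF g(1) E.hom_closed[OF d]] DE[OF d] by simp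
    moreover have "\<phi> (g \<otimes>\<^bsub>A\<^esub> E d) = w"
      using phi.hom_mult[OF g(1) E.hom_closed[OF d]] E1[OF d] g(2) w by simp
    moreover have "g \<otimes>\<^bsub>A\<^esub> E d \<in> carrier A" using g(1) E.hom_closed[OF d] by simp
    ultimately show "\<exists>g. g \<in> carrier A \<and> DA g = c \<and> \<phi> g = w" by blast
  next
    fix g h
    assume "g \<in> carrier A \<and> DA g = c \<and> \<phi> g = w" "h \<in> carrier A \<and> DA h = c \<and> \<phi> h = w"
    then have g: "g \<in> carrier A" "DA g = c" "\<phi> g = w" and h: "h \<in> carrier A" "DA h = c" "\<phi> h = w"
      by auto
    let ?z = "g \<otimes>\<^bsub>A\<^esub> inv\<^bsub>A\<^esub> h"
    have z: "?z \<in> carrier A" "\<phi> ?z = \<one>\<^bsub>W\<^esub>" using g h w by simp_all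
    have Dz: "DA ?z = \<one>\<^bsub>?C\<^esub>"
      unfolding DA.hom_mult[OF g(1) A.inv_closed[OF h(1)]] DA.hom_inv[OF h(1)] g(2) h(2)
      by (rule C.r_inv[OF c])
    obtain d where d: "d \<in> carrier ?C" "?z = E d"
      using ker_phi_subset_squares[OF E E1 Eb z] by blast
    have "d \<otimes>\<^bsub>?C\<^esub> d = \<one>\<^bsub>?C\<^esub>" using DE[OF d(1)] Dz d(2) by simp
    then have "d r + d r = 0" if "r \<in> R" for r
      using that by (auto simp: fun_eq_iff dest: spec[of _ r])
    then have "d = \<one>\<^bsub>?C\<^esub>"
      using d(1) by (auto simp: carrier_cyclic_sum extensional_def fun_eq_iff)
    then have "?z = \<one>\<^bsub>A\<^esub>" using d(2) E.hom_one by simp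
    then show "g = h" using g(1) h(1) A.inv_equality[of g "inv\<^bsub>A\<^esub> h"] by simp
  qed
qed

end

theorem theorem3p8:
  fixes S R :: "'s set" and m :: "'s \<Rightarrow> 's \<Rightarrow> enat"
  assumes "coxeter_system S m"
    and "complete_reps S m R"
  shows "pullback_square TYPE('t)
    (coxeter_adjoint S m)
    (sum_group R (\<lambda>_. integer_group))
    (coxeter_group S m)
    (sum_group R (\<lambda>_. integer_mod_group 2))
    (ab_coords (coxeter_adjoint S m) integer_group R
      (\<lambda>r. coxeter_adjoint_gen S m (coxeter_gen S m r)))
    (coxeter_phi S m)
    (reduce_mod2 R)
    (ab_coords (coxeter_group S m) (integer_mod_group 2) R (coxeter_gen S m))"
proof -
  interpret coxeter_with_reps S R m using assms by (rule coxeter_with_reps.intro)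
  obtain DA where DA: "DA \<in> hom A (cyclic_sum 0 R)"
    "\<And>x. x \<in> X \<Longrightarrow> DA (e x) = basis_vec 0 R (class_rep x)" using A_degree by blast
  obtain DW where DW: "DW \<in> hom W (cyclic_sum 2 R)"
    "\<And>s. s \<in> S \<Longrightarrow> DW (\<sigma> s) = basis_vec 2 R (class_rep (\<sigma> s))" using W_degree by blast
  let ?p = "ab_coords A (integer_mod_group 0) R (\<lambda>r. e (\<sigma> r))"
    and ?q = "ab_coords W (integer_mod_group 2) R \<sigma>"
  have p: "?p g = DA g" if "g \<in> carrier A" for g
  proof (rule ab_coords_eq[OF A.is_group _ DA(1) _ _ generate_e_sigma _ that])
    show "(\<lambda>r. e (\<sigma> r)) \<in> R \<rightarrow> carrier A" by (simp add: R_S sigma_X e_closed)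
    show "DA (e (\<sigma> r)) = basis_vec 0 R r" if "r \<in> R" for r
      using that by (simp add: DA(2) sigma_X R_S class_rep_sigma)
    show "e (\<sigma> r) [^]\<^bsub>A\<^esub> (0::nat) = \<one>\<^bsub>A\<^esub>" for r by simp
    show "\<exists>r\<in>R. \<exists>g\<in>carrier A. t = conj_op A (e (\<sigma> r)) g" if "t \<in> (\<lambda>s. e (\<sigma> s)) ` S" for t
      using that e_sigma_conj_rep by auto
  qed
  have q: "?q w = DW w" if "w \<in> carrier W" for w
  proof (rule ab_coords_eq[OF W.is_group _ DW(1) _ _ generate_sigma _ that])
    show "\<sigma> \<in> R \<rightarrow> carrier W" by (simp add: R_S sigma_closed)
    show "DW (\<sigma> r) = basis_vec 2 R r" if "r \<in> R" for r
      using that by (simp add: DW(2) R_S class_rep_sigma)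
    show "\<sigma> r [^]\<^bsub>W\<^esub> (2::nat) = \<one>\<^bsub>W\<^esub>" if "r \<in> R" for r
      using that by (simp add: numeral_2_eq_2 sigma_involution sigma_closed R_S)
    show "\<exists>r\<in>R. \<exists>w\<in>carrier W. t = conj_op W (\<sigma> r) w" if "t \<in> \<sigma> ` S" for t
      using that class_rep sigma_X by blast
  qed
  have comm: "reduce_mod2 R (DA g) = DW (\<phi> g)" if "g \<in> carrier A" for g
  proof -
    have "(reduce_mod2 R \<circ> DA) g = (DW \<circ> \<phi>) g"
    proof (rule hom_eq_on_generate[OF A.is_group _ Group.hom_compose[OF DA(1) reduce_mod2_hom]
          Group.hom_compose[OF coxeter_phi(1) DW(1)]])
      show "(\<lambda>s. e (\<sigma> s)) ` S \<subseteq> carrier A" by (auto simp: e_closed sigma_X)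
      show "g \<in> generate A ((\<lambda>s. e (\<sigma> s)) ` S)" using that by (simp only: generate_e_sigma)
      show "(reduce_mod2 R \<circ> DA) t = (DW \<circ> \<phi>) t" if "t \<in> (\<lambda>s. e (\<sigma> s)) ` S" for t
        using that by (auto simp: DA(2) DW(2) phi_e sigma_X reduce_mod2_basis_vec)
    qed simp
    then show ?thesis by simp
  qed
  have "?p \<in> hom A (cyclic_sum 0 R)" using DA(1) by (auto simp: hom_def p Pi_iff)
  moreover have "?q \<in> hom W (cyclic_sum 2 R)" using DW(1) by (auto simp: hom_def q Pi_iff)
  ultimately have "pullback_square TYPE('t) A (cyclic_sum 0 R) W (cyclic_sum 2 R) ?p \<phi> (reduce_mod2 R) ?q"
  proof (intro pullback_squareI A.is_group W.is_group coxeter_phi(1) reduce_mod2_hom)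
    show "reduce_mod2 R (?p g) = ?q (\<phi> g)" if "g \<in> carrier A" for g
      using that comm p q by simp
    show "\<exists>!g. g \<in> carrier A \<and> ?p g = c \<and> \<phi> g = w"
      if "c \<in> carrier (cyclic_sum 0 R)" "w \<in> carrier W" "reduce_mod2 R c = ?q w" for c w
      using square_bijective[OF DA comm that(1,2)] that(3) q[OF that(2)] p by (metis (no_types, lifting))
  qed simp_all
  then show ?thesis by (simp only: integer_mod_group_zero)
qed

end
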